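(* Let $M$ be a complete metric space with a designated origin $0\in M$ and let $X$ be a non-zero Banach space such that the pair $(M,X)$ has the contraction-extension property (CEP). If $M$ is unbounded or is not uniformly discrete, then $\mathrm{Lip}_0(M,X)$ has the symmetric strong diameter two property (SSD2P). In particular, if $X=Y^*$ for some Banach space $Y$, then additionally the norm of $\mathcal{F}(M,Y)^{**}$ is octahedral.
   Context: All Banach spaces are real. $B_X$, $S_X$ denote the closed unit ball and unit sphere of a Banach space $X$. For a metric space $(M,d)$ with designated origin $0\in M$ and a Banach space $X$, $\mathrm{Lip}_0(M,X)$ is the Banach space of Lipschitz functions $f:M\to X$ with $f(0)=0$, with norm $\|f\|=\sup_{x\neq y}\frac{\|f(x)-f(y)\|}{d(x,y)}$. For a Banach space $Y$, let $\delta_{m,y}\in \mathrm{Lip}_0(M,Y^* )^*$ be given by $\delta_{m,y}(f)=f(m)(y)$ for $m\in M$, $y\in Y$, and let $\mathcal{F}(M,Y)=\overline{\mathrm{span}}\{\delta_{m,y}: m\in M, y\in Y\}\subseteq \mathrm{Lip}_0(M,Y^* )^*$; one has $\mathcal{F}(M,Y)^*=\mathrm{Lip}_0(M,Y^* )$ isometrically. $M$ is uniformly discrete if $\inf_{x\neq y}d(x,y)>0$. The pair $(M,X)$ has the CEP if for every $N\subseteq M$ and every Lipschitz function $f:N\to X$ there is a Lipschitz function $F:M\to X$ extending $f$ with the same Lipschitz constant as $f$. A slice of $B_Z$ (for a Banach space $Z$) is a set $S(B_Z,f,\alpha)=\{z\in B_Z: f(z)>1-\alpha\}$ with $f\in S_{Z^*}$,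 $\alpha>0$. $Z$ has the SSD2P if for every $k\in\mathbb{N}$, all slices $S_1,\dots,S_k$ of $B_Z$ and every $\varepsilon>0$, there are $x_i\in S_i$ and $\varphi\in B_Z$ with $\|\varphi\|>1-\varepsilon$ such that $x_i\pm\varphi\in S_i$ for every $i\in\{1,\dots,k\}$. The norm of $Z$ is octahedral if for every finite-dimensional subspace $E$ of $Z$ and every $\varepsilon>0$ there is $z\in S_Z$ such that $\|y+\lambda z\|\geq(1-\varepsilon)(\|y\|+|\lambda|)$ for all $y\in E$, $\lambda\in\mathbb{R}$. *)

theory Defs
  imports "HOL-Analysis.Analysis"
begin

class pointed_metric_space = metric_space +
  fixes origin :: 'a

text \<open>The least Lipschitz constant of \<open>f\<close> on \<open>N\<close>. Inserting \<open>0\<close> only matters when \<open>N\<close> has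
  at most one point, where the supremum would otherwise range over the empty set.\<close>

definition lip_const :: "'m::metric_space set \<Rightarrow> ('m \<Rightarrow> 'x::real_normed_vector) \<Rightarrow> real" where
  "lip_const N f = Sup (insert 0 {norm (f x - f y) / dist x y | x y. x \<in> N \<and> y \<in> N \<and> x \<noteq> y})"

definition lipschitz_fun_on :: "'m::metric_space set \<Rightarrow> ('m \<Rightarrow> 'x::real_normed_vector) \<Rightarrow> bool" where
  "lipschitz_fun_on N f \<longleftrightarrow> (\<exists>L. L-lipschitz_on N f)"

text \<open>A function from \<open>N\<close> to \<open>X\<close> is represented by a total function of which only the values
  on \<open>N\<close> are used.\<close>

definition CEP :: "'m::metric_space itself \<Rightarrow> 'x::real_normed_vector itself \<Rightarrow> bool" where
  "CEP _ _ \<longleftrightarrow> (\<forall>(N :: 'm set) (f :: 'm \<Rightarrow> 'x). lipschitz_fun_on N f \<longrightarrow>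
     (\<exists>F :: 'm \<Rightarrow> 'x. lipschitz_fun_on UNIV F \<and> (\<forall>x\<in>N. F x = f x) \<and>
        lip_const UNIV F = lip_const N f))"

lemma lip_const_le:
  assumes "L-lipschitz_on N f"
  shows "lip_const N f \<le> L"
  unfolding lip_const_def
proof (rule cSup_least)
  fix r assume "r \<in> insert 0 {norm (f x - f y) / dist x y | x y. x \<in> N \<and> y \<in> N \<and> x \<noteq> y}"
  then show "r \<le> L"
    using assms by (auto simp: lipschitz_on_def dist_norm divide_le_eq)
qed simp

lemma lipschitz_on_lip_const:
  assumes "lipschitz_fun_on N f"
  shows "(lip_const N f)-lipschitz_on N f"
proof -
  let ?S = "insert 0 {norm (f x - f y) / dist x y | x y. x \<in> N \<and> y \<in> N \<and> x \<noteq> y}"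
  obtain L where L: "L-lipschitz_on N f"
    using assms by (auto simp: lipschitz_fun_on_def)
  have bdd: "bdd_above ?S"
    by (rule bdd_aboveI[of _ L]) (use L in \<open>auto simp: lipschitz_on_def dist_norm divide_le_eq\<close>)
  show ?thesis
  proof (rule lipschitz_onI)
    show "0 \<le> lip_const N f"
      unfolding lip_const_def by (rule cSup_upper[OF _ bdd]) simp
    fix x y assume xy: "x \<in> N" "y \<in> N"
    show "dist (f x) (f y) \<le> lip_const N f * dist x y"
    proof (cases "x = y")
      case False
      have "norm (f x - f y) / dist x y \<le> lip_const N f"
        unfolding lip_const_def by (rule cSup_upper[OF _ bdd]) (use xy False in blast)
      then show ?thesis
        using False by (simp add: dist_norm divide_le_eq)
    qed simp
  qed
qed

typedef (overloaded) ('m::pointed_metric_space, 'x::real_normed_vector) lip0 =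
  "{f :: 'm \<Rightarrow> 'x. f origin = 0 \<and> lipschitz_fun_on UNIV f}"
  morphisms lip0_apply Abs_lip0
  by (rule exI[of _ "\<lambda>_. 0"]) (auto simp: lipschitz_fun_on_def intro: lipschitz_intros)

setup_lifting type_definition_lip0

instantiation lip0 :: (pointed_metric_space, real_normed_vector) real_normed_vector
begin

lift_definition zero_lip0 :: "('a, 'b) lip0" is "\<lambda>_. 0"
  by (auto simp: lipschitz_fun_on_def intro: lipschitz_intros)

lift_definition plus_lip0 :: "('a, 'b) lip0 \<Rightarrow> ('a, 'b) lip0 \<Rightarrow> ('a, 'b) lip0"
  is "\<lambda>f g x. f x + g x"
  by (auto simp: lipschitz_fun_on_def intro: lipschitz_intros)

lift_definition minus_lip0 :: "('a, 'b) lip0 \<Rightarrow> ('a, 'b) lip0 \<Rightarrow> ('a, 'b) lip0"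
  is "\<lambda>f g x. f x - g x"
  by (auto simp: lipschitz_fun_on_def intro: lipschitz_intros)

lift_definition uminus_lip0 :: "('a, 'b) lip0 \<Rightarrow> ('a, 'b) lip0"
  is "\<lambda>f x. - f x"
  by (auto simp: lipschitz_fun_on_def intro: lipschitz_intros)

lift_definition scaleR_lip0 :: "real \<Rightarrow> ('a, 'b) lip0 \<Rightarrow> ('a, 'b) lip0"
  is "\<lambda>c f x. c *\<^sub>R f x"
  by (auto simp: lipschitz_fun_on_def intro: lipschitz_intros)

lift_definition norm_lip0 :: "('a, 'b) lip0 \<Rightarrow> real" is "lip_const UNIV" .

definition dist_lip0 :: "('a, 'b) lip0 \<Rightarrow> ('a, 'b) lip0 \<Rightarrow> real"
  where "dist_lip0 f g = norm (f - g)"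

definition sgn_lip0 :: "('a, 'b) lip0 \<Rightarrow> ('a, 'b) lip0"
  where "sgn_lip0 f = scaleR (inverse (norm f)) f"

definition [code del]:
  "(uniformity :: (('a, 'b) lip0 \<times> ('a, 'b) lip0) filter) =
     (INF e\<in>{0 <..}. principal {(x, y). dist x y < e})"

definition open_lip0 :: "('a, 'b) lip0 set \<Rightarrow> bool"
  where [code del]: "open_lip0 S = (\<forall>x\<in>S. \<forall>\<^sub>F (x', y) in uniformity. x' = x \<longrightarrow> y \<in> S)"

instance
proof
  fix f g h :: "('a, 'b) lip0" and a b :: real
  show "f + g + h = f + (g + h)" "f + g = g + f" "0 + f = f" "- f + f = 0" "f - g = f + - g"
    "a *\<^sub>R (f + g) = a *\<^sub>R f + a *\<^sub>R g" "(a + b) *\<^sub>R f = a *\<^sub>R f + b *\<^sub>R f"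
    "a *\<^sub>R b *\<^sub>R f = (a * b) *\<^sub>R f" "1 *\<^sub>R f = f"
    by (transfer; simp add: algebra_simps)+
  show "dist f g = norm (f - g)" by (rule dist_lip0_def)
  show "sgn f = inverse (norm f) *\<^sub>R f" by (rule sgn_lip0_def)
  show "(uniformity :: (('a, 'b) lip0 \<times> ('a, 'b) lip0) filter) =
      (INF e\<in>{0 <..}. principal {(x, y). dist x y < e})"
    by (rule uniformity_lip0_def)
  show "open U = (\<forall>x\<in>U. \<forall>\<^sub>F (x', y) in uniformity. x' = x \<longrightarrow> y \<in> U)"
    for U :: "('a, 'b) lip0 set"
    by (rule open_lip0_def)
  have ge: "\<And>f :: ('a, 'b) lip0. 0 \<le> norm f"
    by transfer (use lipschitz_on_lip_const lipschitz_on_nonneg in blast)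
  show "norm f = 0 \<longleftrightarrow> f = 0"
  proof
    show "f = 0" if "norm f = 0"
      using that
    proof transfer
      fix f :: "'a \<Rightarrow> 'b"
      assume f: "f origin = 0 \<and> lipschitz_fun_on UNIV f" and "lip_const UNIV f = 0"
      then have "0-lipschitz_on UNIV f"
        using lipschitz_on_lip_const[of UNIV f] by simp
      then have "f x = f origin" for x
        using lipschitz_onD[of 0 UNIV f x origin] by simp
      then show "f = (\<lambda>_. 0)"
        using f by auto
    qed
    have "norm (0 :: ('a, 'b) lip0) \<le> 0"
      by transfer (auto intro!: lip_const_le lipschitz_intros)
    then show "norm f = 0" if "f = 0"
      using that ge[of f] by simp
  qed
  show "norm (f + g) \<le> norm f + norm g"
    by transfer (intro lip_const_le lipschitz_on_add lipschitz_on_lip_const; simp)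
  have le: "norm (c *\<^sub>R k) \<le> \<bar>c\<bar> * norm k" for c and k :: "('a, 'b) lip0"
    by transfer (intro lip_const_le lipschitz_on_cmult lipschitz_on_lip_const; simp)
  show "norm (a *\<^sub>R f) = \<bar>a\<bar> * norm f"
  proof (cases "a = 0")
    case True
    then show ?thesis using le[of a f] ge[of "a *\<^sub>R f"] by simp
  next
    case False
    have "f = inverse a *\<^sub>R (a *\<^sub>R f)"
      using False by transfer simp
    then have "norm f \<le> \<bar>inverse a\<bar> * norm (a *\<^sub>R f)"
      using le[of "inverse a" "a *\<^sub>R f"] by simp
    then have "\<bar>a\<bar> * norm f \<le> norm (a *\<^sub>R f)"
      using False by (simp add: field_simps abs_inverse)
    then show ?thesis using le[of a f] by simp
  qed
qed

end

lemma norm_lip0_apply_diff: "norm (lip0_apply f x - lip0_apply f y) \<le> norm f * dist x y"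
  for f :: "('m::pointed_metric_space, 'x::real_normed_vector) lip0"
proof transfer
  fix f :: "'m \<Rightarrow> 'x" and x y
  assume "f origin = 0 \<and> lipschitz_fun_on UNIV f"
  then show "norm (f x - f y) \<le> lip_const UNIV f * dist x y"
    using lipschitz_onD[OF lipschitz_on_lip_const, of UNIV f x y] by (simp add: dist_norm)
qed

lemma norm_lip0_apply: "norm (lip0_apply f x) \<le> norm f * dist x origin"
  using norm_lip0_apply_diff[of f x origin] lip0_apply[of f] by simp

lemma norm_lip0_le:
  assumes "\<And>x y. norm (lip0_apply f x - lip0_apply f y) \<le> L * dist x y" "0 \<le> L"
  shows "norm f \<le> L"
  unfolding norm_lip0.rep_eq
  by (intro lip_const_le lipschitz_onI) (simp_all add: dist_norm assms)

instance lip0 :: (pointed_metric_space, banach) banach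
proof
  fix X :: "nat \<Rightarrow> ('a, 'b) lip0"
  assume X: "Cauchy X"
  obtain B where B: "\<And>n. norm (X n) \<le> B"
    using cauchy_imp_bounded[OF X] by (auto simp: bounded_iff)
  have B0: "0 \<le> B" using B[of 0] norm_ge_zero[of "X 0"] by linarith
  have "Cauchy (\<lambda>n. lip0_apply (X n) x)" for x
  proof (rule CauchyI)
    fix e :: real assume e: "0 < e"
    have pos: "0 < dist x origin + 1" by (simp add: add_nonneg_pos)
    define d where "d = e / (dist x origin + 1)"
    have d: "0 < d" using e pos by (simp add: d_def)
    obtain N where N: "\<And>m n. m \<ge> N \<Longrightarrow> n \<ge> N \<Longrightarrow> norm (X m - X n) < d"
      using CauchyD[OF X d] by blast
    have "norm (lip0_apply (X m) x - lip0_apply (X n) x) < e" if "m \<ge> N" "n \<ge> N" for m n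
    proof -
      have "norm (lip0_apply (X m) x - lip0_apply (X n) x) \<le> norm (X m - X n) * dist x origin"
        using norm_lip0_apply[of "X m - X n" x] by (simp add: minus_lip0.rep_eq)
      also have "\<dots> \<le> d * dist x origin"
        using N[OF that] by (intro mult_right_mono) auto
      also have "\<dots> < d * (dist x origin + 1)" using d by simp
      also have "\<dots> = e" using pos by (simp add: d_def)
      finally show ?thesis .
    qed
    then show "\<exists>N. \<forall>m\<ge>N. \<forall>n\<ge>N. norm (lip0_apply (X m) x - lip0_apply (X n) x) < e"
      by blast
  qed
  then have "\<forall>x. \<exists>l. (\<lambda>n. lip0_apply (X n) x) \<longlonglongrightarrow> l"
    by (auto simp: Cauchy_convergent_iff convergent_def)
  then obtain g where g: "\<And>x. (\<lambda>n. lip0_apply (X n) x) \<longlonglongrightarrow> g x"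
    by metis
  have lip_lim: "norm (h x - h y) \<le> L * dist x y"
    if "\<And>x. (\<lambda>n. lip0_apply (Y n) x) \<longlonglongrightarrow> h x" "\<forall>\<^sub>F n in sequentially. norm (Y n) \<le> L"
    for Y :: "nat \<Rightarrow> ('a, 'b) lip0" and h x y L
  proof (rule tendsto_upperbound[OF tendsto_norm[OF tendsto_diff[OF that(1) that(1)]]])
    show "\<forall>\<^sub>F n in sequentially. norm (lip0_apply (Y n) x - lip0_apply (Y n) y) \<le> L * dist x y"
      using that(2)
    proof eventually_elim
      case (elim n)
      then show ?case
        using norm_lip0_apply_diff[of "Y n" x y] mult_right_mono[OF elim, of "dist x y"] by simp
    qed
  qed simp
  have "norm (g x - g y) \<le> B * dist x y" for x y
    by (rule lip_lim[OF g]) (simp add: B)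
  then have "B-lipschitz_on UNIV g"
    using B0 by (auto intro!: lipschitz_onI simp: dist_norm)
  moreover have "g origin = 0"
  proof -
    have "lip0_apply (X n) origin = 0" for n
      using lip0_apply[of "X n"] by simp
    then show ?thesis using g[of origin] by (simp add: LIMSEQ_const_iff)
  qed
  ultimately have G: "lip0_apply (Abs_lip0 g) = g"
    by (intro Abs_lip0_inverse) (auto simp: lipschitz_fun_on_def)
  have "X \<longlonglongrightarrow> Abs_lip0 g"
  proof (rule LIMSEQ_I)
    fix e :: real assume e: "0 < e"
    then have "0 < e / 2" by simp
    then obtain N where N: "\<And>m n. m \<ge> N \<Longrightarrow> n \<ge> N \<Longrightarrow> norm (X m - X n) < e / 2"
      using CauchyD[OF X] by blast
    have "norm (X n - Abs_lip0 g) \<le> e / 2" if n: "n \<ge> N" for n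
    proof (rule norm_lip0_le)
      show "norm (lip0_apply (X n - Abs_lip0 g) x - lip0_apply (X n - Abs_lip0 g) y) \<le> e / 2 * dist x y" for x y
      proof (rule lip_lim[of "\<lambda>m. X n - X m"])
        show "(\<lambda>m. lip0_apply (X n - X m) x) \<longlonglongrightarrow> lip0_apply (X n - Abs_lip0 g) x" for x
          by (auto simp: minus_lip0.rep_eq G intro!: tendsto_intros g)
        show "\<forall>\<^sub>F m in sequentially. norm (X n - X m) \<le> e / 2"
          unfolding eventually_sequentially
          using less_imp_le[OF N[OF n]] by blast
      qed
    qed (use e in simp)
    moreover have "e / 2 < e" using e by simp
    ultimately show "\<exists>N. \<forall>n\<ge>N. norm (X n - Abs_lip0 g) < e"
      by (intro exI[of _ N]) (meson le_less_trans)
  qed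
  then show "convergent X" by (rule convergentI)
qed

type_synonym 'z dual = "'z \<Rightarrow>\<^sub>L real"

lift_definition lf_delta ::
    "'m::pointed_metric_space \<Rightarrow> 'y::real_normed_vector \<Rightarrow> ('m, 'y dual) lip0 dual"
  is "\<lambda>m y f. blinfun_apply (lip0_apply f m) y"
proof (rule bounded_linear_intro)
  fix m :: 'm and y :: 'y and f g :: "('m, 'y dual) lip0" and r :: real
  show "blinfun_apply (lip0_apply (f + g) m) y
      = blinfun_apply (lip0_apply f m) y + blinfun_apply (lip0_apply g m) y"
    by (simp add: plus_lip0.rep_eq plus_blinfun.rep_eq)
  show "blinfun_apply (lip0_apply (r *\<^sub>R f) m) y = r *\<^sub>R blinfun_apply (lip0_apply f m) y"
    by (simp add: scaleR_lip0.rep_eq scaleR_blinfun.rep_eq)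
  have "norm (blinfun_apply (lip0_apply f m) y) \<le> norm (lip0_apply f m) * norm y"
    by (rule norm_blinfun)
  also have "\<dots> \<le> norm f * dist m origin * norm y"
    by (intro mult_right_mono norm_lip0_apply) simp
  finally show "norm (blinfun_apply (lip0_apply f m) y) \<le> norm f * (dist m origin * norm y)"
    by (simp add: mult.assoc)
qed

lemma subspace_closure_span: "subspace (closure (span S))"
  for S :: "'z::real_normed_vector set"
  unfolding subspace_def
proof (intro conjI ballI allI)
  show "0 \<in> closure (span S)"
    using closure_subset span_zero by blast
next
  fix x y assume "x \<in> closure (span S)" "y \<in> closure (span S)"
  then obtain u v where uv: "\<And>n. u n \<in> span S" "u \<longlonglongrightarrow> x" "\<And>n. v n \<in> span S" "v \<longlonglongrightarrow> y"
    unfolding closure_sequential by blast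
  then have "(\<lambda>n. u n + v n) \<longlonglongrightarrow> x + y" "\<And>n. u n + v n \<in> span S"
    by (auto intro: tendsto_add span_add)
  then show "x + y \<in> closure (span S)"
    unfolding closure_sequential by (intro exI[of _ "\<lambda>n. u n + v n"]) simp
next
  fix c :: real and x assume "x \<in> closure (span S)"
  then obtain u where u: "\<And>n. u n \<in> span S" "u \<longlonglongrightarrow> x"
    unfolding closure_sequential by blast
  then have "(\<lambda>n. c *\<^sub>R u n) \<longlonglongrightarrow> c *\<^sub>R x" "\<And>n. c *\<^sub>R u n \<in> span S"
    by (auto intro: tendsto_scaleR span_scale)
  then show "c *\<^sub>R x \<in> closure (span S)"
    unfolding closure_sequential by (intro exI[of _ "\<lambda>n. c *\<^sub>R u n"]) simp
qed

typedef (overloaded) ('m::pointed_metric_space, 'y::real_normed_vector) lip_free =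
  "closure (span {lf_delta m y | m y. True}) :: ('m, 'y dual) lip0 dual set"
  morphisms lip_free_emb Abs_lip_free
  using subspace_0[OF subspace_closure_span] by blast

setup_lifting type_definition_lip_free

instantiation lip_free :: (pointed_metric_space, real_normed_vector) real_normed_vector
begin

lift_definition zero_lip_free :: "('a, 'b) lip_free" is 0
  by (rule subspace_0[OF subspace_closure_span])

lift_definition plus_lip_free :: "('a, 'b) lip_free \<Rightarrow> ('a, 'b) lip_free \<Rightarrow> ('a, 'b) lip_free" is "(+)"
  by (rule subspace_add[OF subspace_closure_span])

lift_definition minus_lip_free :: "('a, 'b) lip_free \<Rightarrow> ('a, 'b) lip_free \<Rightarrow> ('a, 'b) lip_free" is "(-)"
  by (rule subspace_diff[OF subspace_closure_span])

lift_definition uminus_lip_free :: "('a, 'b) lip_free \<Rightarrow> ('a, 'b) lip_free" is uminus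
  by (rule subspace_neg[OF subspace_closure_span])

lift_definition scaleR_lip_free :: "real \<Rightarrow> ('a, 'b) lip_free \<Rightarrow> ('a, 'b) lip_free" is "(*\<^sub>R)"
  by (rule subspace_scale[OF subspace_closure_span])

lift_definition norm_lip_free :: "('a, 'b) lip_free \<Rightarrow> real" is norm .

definition dist_lip_free :: "('a, 'b) lip_free \<Rightarrow> ('a, 'b) lip_free \<Rightarrow> real"
  where "dist_lip_free f g = norm (f - g)"

definition sgn_lip_free :: "('a, 'b) lip_free \<Rightarrow> ('a, 'b) lip_free"
  where "sgn_lip_free f = scaleR (inverse (norm f)) f"

definition [code del]:
  "(uniformity :: (('a, 'b) lip_free \<times> ('a, 'b) lip_free) filter) =
     (INF e\<in>{0 <..}. principal {(x, y). dist x y < e})"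

definition open_lip_free :: "('a, 'b) lip_free set \<Rightarrow> bool"
  where [code del]: "open_lip_free S = (\<forall>x\<in>S. \<forall>\<^sub>F (x', y) in uniformity. x' = x \<longrightarrow> y \<in> S)"

instance
proof
  fix f g h :: "('a, 'b) lip_free" and a b :: real
  show "f + g + h = f + (g + h)" "f + g = g + f" "0 + f = f" "- f + f = 0" "f - g = f + - g"
    "a *\<^sub>R (f + g) = a *\<^sub>R f + a *\<^sub>R g" "(a + b) *\<^sub>R f = a *\<^sub>R f + b *\<^sub>R f"
    "a *\<^sub>R b *\<^sub>R f = (a * b) *\<^sub>R f" "1 *\<^sub>R f = f"
    by (transfer; simp add: algebra_simps)+
  show "dist f g = norm (f - g)" by (rule dist_lip_free_def)
  show "sgn f = inverse (norm f) *\<^sub>R f" by (rule sgn_lip_free_def)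
  show "(uniformity :: (('a, 'b) lip_free \<times> ('a, 'b) lip_free) filter) =
      (INF e\<in>{0 <..}. principal {(x, y). dist x y < e})"
    by (rule uniformity_lip_free_def)
  show "open U = (\<forall>x\<in>U. \<forall>\<^sub>F (x', y) in uniformity. x' = x \<longrightarrow> y \<in> U)"
    for U :: "('a, 'b) lip_free set"
    by (rule open_lip_free_def)
  show "norm f = 0 \<longleftrightarrow> f = 0" by transfer simp
  show "norm (f + g) \<le> norm f + norm g" by transfer (rule norm_triangle_ineq)
  show "norm (a *\<^sub>R f) = \<bar>a\<bar> * norm f" by transfer simp
qed

end

instance lip_free :: (pointed_metric_space, real_normed_vector) banach
proof
  fix X :: "nat \<Rightarrow> ('a, 'b) lip_free"
  assume X: "Cauchy X"
  let ?S = "closure (span {lf_delta m y | m y. True}) :: ('a, 'b dual) lip0 dual set"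
  have nrm: "norm (f - g) = norm (lip_free_emb f - lip_free_emb g)" for f g :: "('a, 'b) lip_free"
    by transfer simp
  have "Cauchy (\<lambda>n. lip_free_emb (X n))"
    using X by (simp add: Cauchy_def dist_norm nrm)
  then obtain l where lim: "(\<lambda>n. lip_free_emb (X n)) \<longlonglongrightarrow> l"
    using Cauchy_convergent convergent_def by blast
  have l: "l \<in> ?S"
    by (rule closed_sequentially[OF closed_closure _ lim]) (rule lip_free_emb)
  have "X \<longlonglongrightarrow> Abs_lip_free l"
    using lim by (simp add: LIMSEQ_iff nrm Abs_lip_free_inverse[OF l])
  then show "convergent X" by (rule convergentI)
qed

definition slice :: "'z::real_normed_vector dual \<Rightarrow> real \<Rightarrow> 'z set" where
  "slice f \<alpha> = {z \<in> cball 0 1. blinfun_apply f z > 1 - \<alpha>}"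

definition ball_slices :: "'z::real_normed_vector set set" where
  "ball_slices = {slice f \<alpha> | f \<alpha>. norm f = 1 \<and> \<alpha> > 0}"

definition SSD2P :: "'z::real_normed_vector itself \<Rightarrow> bool" where
  "SSD2P _ \<longleftrightarrow>
     (\<forall>(k::nat) (S :: nat \<Rightarrow> 'z set) (\<epsilon>::real).
        k \<ge> 1 \<longrightarrow> (\<forall>i\<in>{1..k}. S i \<in> ball_slices) \<longrightarrow> \<epsilon> > 0 \<longrightarrow>
        (\<exists>(x :: nat \<Rightarrow> 'z) \<phi>. (\<forall>i\<in>{1..k}. x i \<in> S i) \<and>
           \<phi> \<in> cball 0 1 \<and> norm \<phi> > 1 - \<epsilon> \<and>
           (\<forall>i\<in>{1..k}. x i + \<phi> \<in> S i \<and> x i - \<phi> \<in> S i)))"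

definition octahedral_norm :: "'z::real_normed_vector itself \<Rightarrow> bool" where
  "octahedral_norm _ \<longleftrightarrow>
     (\<forall>(E :: 'z set) (\<epsilon>::real).
        subspace E \<longrightarrow> (\<exists>B. finite B \<and> span B = E) \<longrightarrow> \<epsilon> > 0 \<longrightarrow>
        (\<exists>z. norm z = 1 \<and>
           (\<forall>y\<in>E. \<forall>t::real. norm (y + t *\<^sub>R z) \<ge> (1 - \<epsilon>) * (norm y + \<bar>t\<bar>))))"

definition isometrically_isomorphic ::
    "'x::real_normed_vector itself \<Rightarrow> 'z::real_normed_vector itself \<Rightarrow> bool" where
  "isometrically_isomorphic _ _ \<longleftrightarrow>
     (\<exists>J :: 'x \<Rightarrow> 'z. linear J \<and> surj J \<and> (\<forall>x. norm (J x) = norm x))"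

end

theory Submission
  imports Defs
begin

text \<open>Slices of the unit ball of the Lipschitz space are given by arbitrary functionals, about which little
is known. They can be controlled only through sequences that are weakly null for a reason that every
functional respects, and such a reason is disjointness of supports: if the \<open>h n\<close> are bounded in norm
and have disjoint supports, then all their signed sums are bounded by twice that bound, because a
difference quotient sees only two points. Hence they are weakly null (\<open>disjoint_supports_weakly_null\<close>).

It remains to modify Lipschitz functions on disjoint sets so that there is room for a large
perturbation. Around a pair of points \<open>c \<noteq> p\<close>, consider an annulus with centre \<open>c\<close> that reaches from
radii much smaller to radii much larger than \<open>dist c p\<close>. A function of norm slightly less than one can
be replaced inside the annulus by one that is constant on a smaller annulus; here the
contraction-extension property fills the gap without loss of norm (\<open>flatten_on_annulus\<close>). A bump of
norm almost one, supported deep inside the region of constancy, can then be added or subtracted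
without leaving the unit ball (\<open>add_bump_lipschitz\<close>). The hypotheses on the metric space provide
an infinite sequence of disjoint annuli (\<open>disjoint_annuli_exist\<close>): the points \<open>p\<close>
escape to infinity, or accumulate at a common centre, or the close pairs are separated from each other.
Together this gives the symmetric strong diameter two property (\<open>SSD2P_lip0\<close>).

For the statement about the bidual of the Lipschitz-free space, the Lipschitz space with values in the
dual of \<open>Y\<close> is identified with the dual of the free space (\<open>lip_free_dual_isometry\<close>), and a
dual space with the symmetric strong diameter two property has a dual with octahedral norm
(\<open>SSD2P_imp_octahedral_dual\<close>): a functional that almost norms the symmetric direction \<open>\<phi>\<close> almost
vanishes at the points \<open>x i\<close>, and so is almost \<open>\<ell>\<^sub>1\<close>-orthogonal to every functional whose slice was used.\<close>

section \<open>Flattening a function on an annulus\<close>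

text \<open>The region around \<open>c\<close>, on the scale \<open>r = dist c p\<close>, where \<open>s\<^sup>3 r < dist x c < r / s\<^sup>3\<close>. The two
conditions are multiplied out so that no division by \<open>s\<close> appears.\<close>

definition annulus :: "real \<Rightarrow> 'm::metric_space \<Rightarrow> 'm \<Rightarrow> 'm set" where
  "annulus s c p = {x. s^3 * dist c p < dist x c \<and> s^3 * dist x c < dist c p}"

text \<open>A radial tent of slope one. It vanishes up to radius \<open>s r\<close> and again from \<open>2 r\<close> on, where
\<open>r = dist c p\<close>, and is \<open>(1 - s) r\<close> at \<open>p\<close>; so the pair \<open>(c, p)\<close> alone forces the Lipschitz constant
of the bump to be at least \<open>1 - s\<close>.\<close>

definition bump :: "real \<Rightarrow> 'm::metric_space \<Rightarrow> 'm \<Rightarrow> 'm \<Rightarrow> real" where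
  "bump s c p x = max 0 (min (dist x c - s * dist c p) (2 * dist c p - dist x c))"

text \<open>This is the only place where the contraction-extension property enters. Prescribe \<open>f\<close> off the
annulus and the constant \<open>f c\<close> on the smaller annulus \<open>s\<^sup>2 r \<le> dist x c \<le> r / s\<^sup>2\<close>, and leave the gap
between the two free. A point \<open>x\<close> of the smaller annulus and a point \<open>y\<close> off the larger one differ in
distance from \<open>c\<close> by a factor of at least \<open>1 / s\<close>. If \<open>y\<close> is the nearer one to \<open>c\<close>, then
\<open>dist y c \<le> dist x y\<close>; if it is the farther one, then \<open>(1 - s) dist y c \<le> dist x y\<close>. In both cases
the slope of the prescribed function between \<open>x\<close> and \<open>y\<close> stays within \<open>(1 - 2 s) / (1 - s) \<le> 1 - s\<close>.\<close>

lemma flatten_on_annulus: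
  fixes f :: "'m::metric_space \<Rightarrow> 'x::real_normed_vector"
  assumes CEP: "CEP TYPE('m) TYPE('x)" and s: "0 < s" "s \<le> 1/2"
    and cp: "c \<noteq> p" and f: "(1 - 2 * s)-lipschitz_on UNIV f"
  obtains g where "(1 - s)-lipschitz_on UNIV g" "\<And>x. x \<notin> annulus s c p \<Longrightarrow> g x = f x"
    "\<And>x. s\<^sup>2 * dist c p \<le> dist x c \<Longrightarrow> s\<^sup>2 * dist x c \<le> dist c p \<Longrightarrow> g x = f c"
proof -
  define r where "r = dist c p"
  have r: "0 < r" using cp by (simp add: r_def)
  define U where "U = annulus s c p"
  define V where "V = {x. s\<^sup>2 * r \<le> dist x c \<and> s\<^sup>2 * dist x c \<le> r}"
  define h where "h x = (if x \<in> V then f c else f x)" for x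
  have f_le: "norm (f x - f y) \<le> (1 - 2 * s) * dist x y" for x y
    using lipschitz_onD[OF f, of x y] by (simp add: dist_norm)
  have s3: "s^3 = s * s\<^sup>2" by (simp add: power3_eq_cube power2_eq_square)
  \<comment> \<open>Lipschitz estimate between the region where the constant is prescribed and the region where \<open>f\<close> is.\<close>
  have cross: "(1 - 2 * s) * dist y c \<le> (1 - s) * dist x y" if x: "x \<in> V" and y: "y \<notin> U" for x y
  proof (cases "dist y c \<le> s^3 * r")
    case True
    have "s^3 * r \<le> 1/2 * (s\<^sup>2 * r)"
      unfolding s3 mult.assoc by (rule mult_right_mono) (use s r in auto)
    then have "2 * dist y c \<le> s\<^sup>2 * r" using True by simp
    also have "\<dots> \<le> dist x y + dist y c"
      using x dist_triangle[of x c y] by (simp add: V_def)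
    finally have "dist y c \<le> dist x y" by simp
    then show ?thesis by (intro mult_mono) (use s in auto)
  next
    case False
    then have "r \<le> s^3 * dist y c" using y by (auto simp: U_def annulus_def r_def)
    then have "s\<^sup>2 * dist x c \<le> s\<^sup>2 * (s * dist y c)"
      using x by (simp add: V_def s3 mult.assoc mult.left_commute)
    then have "dist x c \<le> s * dist y c" using s by simp
    then have "(1 - s) * dist y c \<le> dist x y"
      using dist_triangle3[of y c x] by (simp add: algebra_simps)
    moreover have "(1 - 2 * s) * dist y c \<le> (1 - s) * ((1 - s) * dist y c)"
      unfolding mult.assoc[symmetric]
      by (rule mult_right_mono) (auto simp: algebra_simps)
    ultimately show ?thesis
      using mult_left_mono[of "(1 - s) * dist y c" "dist x y" "1 - s"] s by linarith
  qed
  have "(1 - s)-lipschitz_on (- U \<union> V) h"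
  proof (rule lipschitz_onI)
    fix x y assume xy: "x \<in> - U \<union> V" "y \<in> - U \<union> V"
    have *: "norm (f c - f y) \<le> (1 - s) * dist x y" if "x \<in> V" "y \<notin> U" for x y
      using f_le[of c y] cross[OF that] by (simp add: dist_commute)
    have "norm (f x - f y) \<le> (1 - s) * dist x y"
      by (rule order_trans[OF f_le mult_right_mono]) (use s in auto)
    then show "dist (h x) (h y) \<le> (1 - s) * dist x y"
      using xy *[of x y] *[of y x] s
      by (auto simp: h_def dist_norm norm_minus_commute dist_commute)
  qed (use s in simp)
  then have h: "lipschitz_fun_on (- U \<union> V) h" "lip_const (- U \<union> V) h \<le> 1 - s"
    by (auto simp: lipschitz_fun_on_def intro: lip_const_le)
  then obtain g where g: "lipschitz_fun_on UNIV g" "\<forall>x\<in>- U \<union> V. g x = h x"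
    "lip_const UNIV g = lip_const (- U \<union> V) h"
    using CEP unfolding CEP_def by blast
  have VU: "x \<in> U" if "x \<in> V" for x
  proof -
    have "s * (s\<^sup>2 * r) < 1 * (s\<^sup>2 * r)"
      by (rule mult_strict_right_mono) (use s r in auto)
    then have 1: "s^3 * r < dist x c" using that by (simp add: V_def s3 mult.assoc)
    have "0 < dist x c" by (rule le_less_trans[OF _ 1]) (use s r in simp)
    then have "s * (s\<^sup>2 * dist x c) < 1 * (s\<^sup>2 * dist x c)"
      by (intro mult_strict_right_mono) (use s r in auto)
    then have 2: "s^3 * dist x c < r" using that by (simp add: V_def s3 mult.assoc)
    from 1 2 show ?thesis by (simp add: U_def annulus_def r_def)
  qed
  show ?thesis
  proof (rule that)
    show "(1 - s)-lipschitz_on UNIV g"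
      by (rule lipschitz_on_mono[OF lipschitz_on_lip_const[OF g(1)]]) (use g(3) h(2) in auto)
    show "g x = f x" if "x \<notin> annulus s c p" for x
      using that g(2) VU[of x] by (auto simp: h_def U_def)
    show "g x = f c" if "s\<^sup>2 * dist c p \<le> dist x c" "s\<^sup>2 * dist x c \<le> dist c p" for x
      using that g(2) by (auto simp: h_def V_def r_def)
  qed
qed

lemma bump_eq_0: "dist x c \<le> s * dist c p \<or> 2 * dist c p \<le> dist x c \<Longrightarrow> bump s c p x = 0"
  by (auto simp: bump_def)

lemma bump_nonneg: "0 \<le> bump s c p x"
  by (simp add: bump_def)

lemma bump_lipschitz: "\<bar>bump s c p x - bump s c p y\<bar> \<le> dist x y"
proof -
  have "\<bar>dist x c - dist y c\<bar> \<le> dist x y"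
    using abs_dist_diff_le[of x c y] by (simp add: dist_commute)
  then show ?thesis by (auto simp: bump_def max_def min_def abs_le_iff)
qed

lemma bump_eq_0_outside_annulus:
  assumes s: "0 < s" "s \<le> 1/2" and x: "x \<notin> annulus s c p"
  shows "bump s c p x = 0"
proof (rule bump_eq_0)
  define r t where "r = dist c p" and "t = dist x c"
  have nn: "0 \<le> r" "0 \<le> t" by (auto simp: r_def t_def)
  have s3: "s^3 \<le> s"  using s power_decreasing[of 1 3 s] by simp
  have "s^3 \<le> 1/2" using s s3 by linarith
  then have "s^3 * t \<le> 1/2 * t" by (rule mult_right_mono) (use nn in auto)
  moreover have "s^3 * r \<le> s * r" using s3 nn by (intro mult_right_mono)
  ultimately show "dist x c \<le> s * dist c p \<or> 2 * dist c p \<le> dist x c"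
    using x unfolding annulus_def mem_Collect_eq r_def[symmetric] t_def[symmetric] by linarith
qed

text \<open>Where the bump lives, \<open>g\<close> is constant, so the two slopes only compete between a point \<open>x\<close> of the
support of the bump and a point \<open>y\<close> outside the region of constancy. If \<open>y\<close> is close to \<open>c\<close>, then
\<open>g\<close> varies by at most \<open>s\<^sup>2 r\<close>, while the bump at \<open>x\<close> is \<open>s r\<close> below its slope-one bound
\<open>dist x c\<close>; this slack pays for the variation of \<open>g\<close> since \<open>2 s\<^sup>2 r \<le> s r\<close>. If \<open>y\<close> is far from
\<open>c\<close>, the height of the bump, at most \<open>r\<close>, is below \<open>s dist x y\<close>, which is the slack left by the
constant \<open>1 - s\<close> of \<open>g\<close>.\<close>

lemma add_bump_lipschitz:
  fixes g :: "'m::metric_space \<Rightarrow> 'x::real_normed_vector"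
  assumes s: "0 < s" "s \<le> 1/2" and cp: "c \<noteq> p" and e: "norm e \<le> 1"
    and g: "(1 - s)-lipschitz_on UNIV g"
    and const: "\<And>x. s\<^sup>2 * dist c p \<le> dist x c \<Longrightarrow> s\<^sup>2 * dist x c \<le> dist c p \<Longrightarrow> g x = g c"
  shows "1-lipschitz_on UNIV (\<lambda>x. g x + bump s c p x *\<^sub>R e)"
proof -
  define r where "r = dist c p"
  have r: "0 < r" using cp by (simp add: r_def)
  define V where "V = {x. s\<^sup>2 * r \<le> dist x c \<and> s\<^sup>2 * dist x c \<le> r}"
  define b where "b = bump s c p"
  have g_le: "norm (g x - g y) \<le> (1 - s) * dist x y" for x y
    using lipschitz_onD[OF g, of x y] by (simp add: dist_norm)
  have sr: "0 < s * r" using s r by simp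
  have s2r: "2 * (s\<^sup>2 * r) \<le> s * r" "0 < s\<^sup>2 * r"
    using mult_right_mono[of s "1/2" "s * r"] s sr by (auto simp: power2_eq_square mult.assoc)
  have bV: "b x = 0" if "x \<notin> V" for x
    unfolding b_def
  proof (rule bump_eq_0)
    have "s\<^sup>2 \<le> (1/2)\<^sup>2" by (rule power_mono) (use s in auto)
    then have "s\<^sup>2 * dist x c \<le> 1/2 * dist x c"
      by (intro mult_right_mono) (auto simp: power2_eq_square)
    moreover have "dist x c < s\<^sup>2 * r \<or> r < s\<^sup>2 * dist x c" using that by (auto simp: V_def)
    ultimately show "dist x c \<le> s * dist c p \<or> 2 * dist c p \<le> dist x c"
      using s2r by (auto simp: r_def)
  qed
  have cross: "norm (g x - g y) + b x \<le> dist x y" if x: "x \<in> V" and y: "y \<notin> V" for x y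
  proof (cases "b x = 0")
    case True
    have "(1 - s) * dist x y \<le> 1 * dist x y" by (rule mult_right_mono) (use s in auto)
    then show ?thesis using True g_le[of x y] by simp
  next
    case False
    then have bx: "b x \<le> dist x c - s * r" "b x \<le> 2 * r - dist x c" "dist x c < 2 * r"
      by (auto simp: b_def bump_def r_def max_def split: if_splits)
    show ?thesis
    proof (cases "dist y c < s\<^sup>2 * r")
      case True
      have "norm (g x - g y) = norm (g c - g y)"
        using const[of x] x by (simp add: V_def r_def)
      also have "\<dots> \<le> (1 - s) * dist c y" by (rule g_le)
      also have "\<dots> \<le> 1 * dist c y" by (rule mult_right_mono) (use s in auto)
      finally show ?thesis
        using bx(1) True s2r dist_triangle[of x c y] by (simp add: dist_commute)
    next
      case False
      then have *: "r < s\<^sup>2 * dist y c" using y by (auto simp: V_def)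
      have "s * (s * dist y c) \<le> 1/2 * (s * dist y c)" by (rule mult_right_mono) (use s in auto)
      then have "2 * r \<le> s * dist y c" using * by (simp add: power2_eq_square mult.assoc)
      moreover have "s * r \<le> 1/2 * r" by (rule mult_right_mono) (use s r in auto)
      moreover have "s * (dist y c - 2 * r) \<le> s * dist x y"
        by (rule mult_left_mono) (use s bx(3) dist_triangle3[of y c x] in auto)
      ultimately have "r \<le> s * dist x y" by (simp add: algebra_simps)
      moreover have "b x \<le> r" using bx sr by simp
      ultimately show ?thesis using g_le[of x y] by (simp add: algebra_simps)
    qed
  qed
  show ?thesis
  proof (rule lipschitz_onI)
    fix x y :: 'm
    have "norm ((g x + b x *\<^sub>R e) - (g y + b y *\<^sub>R e)) = norm ((g x - g y) + (b x - b y) *\<^sub>R e)"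
      by (simp add: algebra_simps)
    also have "\<dots> \<le> norm (g x - g y) + \<bar>b x - b y\<bar> * norm e"
      by (rule order_trans[OF norm_triangle_ineq]) simp
    also have "\<dots> \<le> norm (g x - g y) + \<bar>b x - b y\<bar>"
      using mult_left_mono[OF e, of "\<bar>b x - b y\<bar>"] by simp
    also have "\<dots> \<le> dist x y"
    proof (cases "x \<in> V"; cases "y \<in> V")
      assume "x \<in> V" "y \<in> V"
      then have "g x = g y" using const[of x] const[of y] by (simp add: V_def r_def)
      then show ?thesis using bump_lipschitz[of s c p x y] by (simp add: b_def)
    next
      assume "x \<in> V" "y \<notin> V"
      then show ?thesis using cross[of x y] bV[of y] bump_nonneg[of s c p x] by (simp add: b_def)
    next
      assume "x \<notin> V" "y \<in> V"
      then show ?thesis using cross[of y x] bV[of x] bump_nonneg[of s c p y]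
        by (simp add: b_def norm_minus_commute dist_commute)
    next
      assume "x \<notin> V" "y \<notin> V"
      moreover have "(1 - s) * dist x y \<le> 1 * dist x y" by (rule mult_right_mono) (use s in auto)
      ultimately show ?thesis using g_le[of x y] bV by simp
    qed
    finally show "dist (g x + bump s c p x *\<^sub>R e) (g y + bump s c p y *\<^sub>R e) \<le> 1 * dist x y"
      by (simp add: dist_norm b_def)
  qed simp
qed

section \<open>Perturbing elements of the Lipschitz space\<close>

lemma lip0_exists:
  assumes "f origin = 0" "L-lipschitz_on UNIV f"
  obtains h where "lip0_apply h = f" "norm h \<le> L"
proof
  show *: "lip0_apply (Abs_lip0 f) = f"
    using assms by (intro Abs_lip0_inverse) (auto simp: lipschitz_fun_on_def)
  show "norm (Abs_lip0 f) \<le> L"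
    unfolding norm_lip0.rep_eq * by (rule lip_const_le) (rule assms)
qed

lemma lip0_lipschitz: "norm f \<le> L \<Longrightarrow> L-lipschitz_on UNIV (lip0_apply f)"
  by (rule lipschitz_onI)
    (auto simp: dist_norm intro: order_trans[OF norm_lip0_apply_diff mult_right_mono] order_trans[OF norm_ge_zero])

lemma lip0_apply_origin: "lip0_apply f origin = 0"
  using lip0_apply[of f] by simp

text \<open>The quantifier order is what the later argument uses: one function \<open>\<phi>\<close>, supported in the annulus and
almost normalised, serves all \<open>f\<close> of norm at most \<open>1 - 2 s\<close> simultaneously.\<close>

lemma lip0_perturbation:
  fixes c p :: "'m::pointed_metric_space" and e :: "'x::real_normed_vector"
  assumes CEP: "CEP TYPE('m) TYPE('x)" and s: "0 < s" "s \<le> 1/2"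
    and cp: "c \<noteq> p" and o: "origin \<notin> annulus s c p" and e: "norm e = 1"
  obtains \<phi> :: "('m, 'x) lip0" where
    "1 - s \<le> norm \<phi>" "norm \<phi> \<le> 1" "\<And>x. x \<notin> annulus s c p \<Longrightarrow> lip0_apply \<phi> x = 0"
    "\<And>f. norm f \<le> 1 - 2 * s \<Longrightarrow> \<exists>g. norm g \<le> 1 \<and> norm (g + \<phi>) \<le> 1 \<and> norm (g - \<phi>) \<le> 1 \<and>
       (\<forall>x. x \<notin> annulus s c p \<longrightarrow> lip0_apply g x = lip0_apply f x)"
proof -
  note b0 = bump_eq_0_outside_annulus[OF s]
  have "1-lipschitz_on UNIV (\<lambda>x. bump s c p x *\<^sub>R e)"
    by (rule lipschitz_onI) (use e in \<open>auto simp: dist_norm bump_lipschitz simp flip: scaleR_diff_left\<close>)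
  then obtain \<phi> :: "('m, 'x) lip0" where
    phi: "lip0_apply \<phi> = (\<lambda>x. bump s c p x *\<^sub>R e)" and phi1: "norm \<phi> \<le> 1"
    using lip0_exists[of "\<lambda>x. bump s c p x *\<^sub>R e" 1] b0[OF o] by auto
  show ?thesis
  proof (rule that)
    have "s * dist c p \<le> 1/2 * dist c p" by (rule mult_right_mono) (use s in auto)
    moreover have "0 \<le> s * dist c p" using s by simp
    ultimately have p: "bump s c p p = (1 - s) * dist c p"
      by (auto simp: bump_def max_def min_def dist_commute algebra_simps)
    have c: "bump s c p c = 0" by (rule bump_eq_0) (use s in \<open>simp add: zero_le_mult_iff\<close>)
    have "(1 - s) * dist c p \<le> norm \<phi> * dist c p"
      using norm_lip0_apply_diff[of \<phi> p c] e s by (simp add: phi p c dist_commute)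
    then show "1 - s \<le> norm \<phi>" using cp by simp
    show "norm \<phi> \<le> 1" by (rule phi1)
    show "lip0_apply \<phi> x = 0" if "x \<notin> annulus s c p" for x
      by (simp add: phi b0[OF that])
  next
    fix f :: "('m, 'x) lip0" assume "norm f \<le> 1 - 2 * s"
    from flatten_on_annulus[OF CEP s cp lip0_lipschitz[OF this]] obtain g where
      g: "(1 - s)-lipschitz_on UNIV g" "\<And>x. x \<notin> annulus s c p \<Longrightarrow> g x = lip0_apply f x"
      "\<And>x. s\<^sup>2 * dist c p \<le> dist x c \<Longrightarrow> s\<^sup>2 * dist x c \<le> dist c p \<Longrightarrow> g x = lip0_apply f c"
      by blast
    have c: "c \<notin> annulus s c p" using s by (auto simp: annulus_def mult_less_0_iff)
    have const: "g x = g c" if "s\<^sup>2 * dist c p \<le> dist x c" "s\<^sup>2 * dist x c \<le> dist c p" for x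
      using g(3)[OF that] g(2)[OF c] by simp
    have o0: "g origin = 0" using g(2)[OF o] by (simp add: lip0_apply_origin)
    then obtain g' where g': "lip0_apply g' = g" "norm g' \<le> 1 - s"
      using lip0_exists[OF _ g(1)] by blast
    have pm: "norm (g' + t *\<^sub>R \<phi>) \<le> 1" if t: "\<bar>t\<bar> = 1" for t
    proof -
      have "1-lipschitz_on UNIV (\<lambda>x. g x + bump s c p x *\<^sub>R (t *\<^sub>R e))"
        by (rule add_bump_lipschitz[OF s cp _ g(1) const]) (use e t in auto)
      moreover have "lip0_apply (g' + t *\<^sub>R \<phi>) = (\<lambda>x. g x + bump s c p x *\<^sub>R (t *\<^sub>R e))"
        by (auto simp: plus_lip0.rep_eq scaleR_lip0.rep_eq g' phi mult.commute)
      ultimately show ?thesis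
        unfolding norm_lip0.rep_eq by (auto intro: lip_const_le)
    qed
    show "\<exists>g. norm g \<le> 1 \<and> norm (g + \<phi>) \<le> 1 \<and> norm (g - \<phi>) \<le> 1 \<and>
       (\<forall>x. x \<notin> annulus s c p \<longrightarrow> lip0_apply g x = lip0_apply f x)"
      using pm[of 1] pm[of "-1"] g' g(2) s by (intro exI[of _ g']) auto
  qed
qed

lemma lip0_apply_sum: "lip0_apply (\<Sum>i\<in>A. h i) x = (\<Sum>i\<in>A. lip0_apply (h i) x)"
  by (induction A rule: infinite_finite_induct) (auto simp: plus_lip0.rep_eq zero_lip0.rep_eq)

section \<open>Disjointly supported sequences are weakly null\<close>

text \<open>For fixed points \<open>x\<close> and \<open>y\<close> at most one summand is nonzero at \<open>x\<close> and at most one at \<open>y\<close>, hence only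
two summands contribute to the difference quotient, however many are added.\<close>

lemma norm_sum_disjoint_supports_le:
  fixes h :: "nat \<Rightarrow> ('m::pointed_metric_space, 'x::real_normed_vector) lip0"
  assumes h: "\<And>n. norm (h n) \<le> L" and disj: "disjoint_family U"
    and supp: "\<And>n x. x \<notin> U n \<Longrightarrow> lip0_apply (h n) x = 0"
  shows "norm (\<Sum>n<N. h n) \<le> 2 * L"
proof (rule norm_lip0_le)
  have L: "0 \<le> L" using h[of 0] norm_ge_zero[of "h 0"] by linarith
  then show "0 \<le> 2 * L" by simp
  fix x y :: 'm
  define A where "A z = {n. n < N \<and> z \<in> U n}" for z
  have fin: "finite (A z)" for z by (simp add: A_def)
  have card: "card (A z) \<le> Suc 0" for z
    using disj by (subst card_le_Suc0_iff_eq[OF fin]) (auto simp: A_def disjoint_family_on_def)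
  have "lip0_apply (\<Sum>n<N. h n) x - lip0_apply (\<Sum>n<N. h n) y
      = (\<Sum>n<N. lip0_apply (h n) x - lip0_apply (h n) y)"
    by (simp add: lip0_apply_sum sum_subtractf)
  also have "\<dots> = (\<Sum>n\<in>A x \<union> A y. lip0_apply (h n) x - lip0_apply (h n) y)"
    by (rule sum.mono_neutral_right) (auto simp: A_def supp)
  also have "norm \<dots> \<le> of_nat (card (A x \<union> A y)) * (L * dist x y)"
    by (rule sum_norm_bound)
      (rule order_trans[OF norm_lip0_apply_diff mult_right_mono], auto simp: h)
  also have "\<dots> \<le> 2 * (L * dist x y)"
  proof (rule mult_right_mono)
    have "card (A x \<union> A y) \<le> 2" using card_Un_le[of "A x" "A y"] card[of x] card[of y] by linarith
    then show "real (card (A x \<union> A y)) \<le> 2" by simp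
  qed (use L in simp)
  finally show "norm (lip0_apply (\<Sum>n<N. h n) x - lip0_apply (\<Sum>n<N. h n) y) \<le> 2 * L * dist x y"
    by simp
qed

text \<open>Choosing signs, \<open>\<Sum>n<N. \<bar>F (h n)\<bar>\<close> is the value of \<open>F\<close> at a signed sum of the \<open>h n\<close>, whose norm is
bounded independently of \<open>N\<close>; so the series of the \<open>\<bar>F (h n)\<bar>\<close> converges.\<close>

lemma disjoint_supports_weakly_null:
  fixes h :: "nat \<Rightarrow> ('m::pointed_metric_space, 'x::real_normed_vector) lip0"
    and F :: "('m, 'x) lip0 dual"
  assumes h: "\<And>n. norm (h n) \<le> L" and disj: "disjoint_family U"
    and supp: "\<And>n x. x \<notin> U n \<Longrightarrow> lip0_apply (h n) x = 0"
  shows "(\<lambda>n. blinfun_apply F (h n)) \<longlonglongrightarrow> 0"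
proof -
  have L: "0 \<le> L" using h[of 0] norm_ge_zero[of "h 0"] by linarith
  have "summable (\<lambda>n. \<bar>blinfun_apply F (h n)\<bar>)"
  proof (rule summableI_nonneg_bounded)
    fix N
    define h' where "h' n = sgn (blinfun_apply F (h n)) *\<^sub>R h n" for n
    have "norm (h' n) \<le> L" for n
      using h[of n] L by (cases "blinfun_apply F (h n) = 0") (auto simp: h'_def)
    moreover have "lip0_apply (h' n) x = 0" if "x \<notin> U n" for n x
      using supp[OF that] by (simp add: h'_def scaleR_lip0.rep_eq)
    ultimately have "norm (\<Sum>n<N. h' n) \<le> 2 * L"
      using norm_sum_disjoint_supports_le[OF _ disj] by blast
    then have "norm F * norm (\<Sum>n<N. h' n) \<le> norm F * (2 * L)"
      by (intro mult_left_mono) auto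
    moreover have "(\<Sum>n<N. \<bar>blinfun_apply F (h n)\<bar>) = blinfun_apply F (\<Sum>n<N. h' n)"
      by (simp add: h'_def blinfun.sum_right blinfun.scaleR_right abs_sgn mult.commute)
    ultimately show "(\<Sum>n<N. \<bar>blinfun_apply F (h n)\<bar>) \<le> norm F * (2 * L)"
      using norm_blinfun[of F "\<Sum>n<N. h' n"] by simp
  qed simp
  then show ?thesis using summable_LIMSEQ_zero tendsto_rabs_zero_iff by blast
qed

section \<open>Infinitely many disjoint annuli\<close>

text \<open>With one centre, two annuli are disjoint as soon as their scales differ by the factor \<open>s\<^sup>6\<close>, so points
\<open>p n\<close> that approach the centre, or that escape to infinity, fast enough give a disjoint sequence.\<close>

lemma disjoint_annuli_common_centre:
  fixes c :: "'m::metric_space"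
  assumes s: "0 < s" "s \<le> 1/2"
    and far: "(\<forall>e>0. \<exists>p. p \<noteq> c \<and> dist c p < e) \<or> (\<forall>e. \<exists>p. e < dist c p)"
  shows "\<exists>p. (\<forall>n::nat. c \<noteq> p n) \<and> disjoint_family (\<lambda>n. annulus s c (p n))"
proof -
  have s6: "0 < s^6" "s^6 < 1" using s by (auto intro: power_Suc_less_one power_less_one_iff[THEN iffD2])
  have disj: "disjoint_family (\<lambda>n. annulus s c (p n))"
    if sep: "\<And>m n. m < n \<Longrightarrow> dist c (p n) < s^6 * dist c (p m) \<or> dist c (p m) < s^6 * dist c (p n)"
    for p :: "nat \<Rightarrow> 'm"
  proof -
    have *: False if "x \<in> annulus s c a" "x \<in> annulus s c b" "dist c b < s^6 * dist c a" for x a b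
    proof -
      have "s^3 * dist x c < s^6 * dist c a" using that by (auto simp: annulus_def)
      also have "s^6 = s^3 * s^3" by (simp flip: power_add)
      finally have "s^3 * dist x c < s^3 * (s^3 * dist c a)" by (simp only: mult.assoc)
      then have "dist x c < s^3 * dist c a" by (rule mult_left_less_imp_less) (use s in simp)
      then show False using that by (auto simp: annulus_def)
    qed
    show ?thesis
      unfolding disjoint_family_on_def disjoint_iff
      using sep * by (metis linorder_neqE_nat)
  qed
  consider "\<forall>e>0. \<exists>p. p \<noteq> c \<and> dist c p < e" | "\<forall>e. \<exists>p. e < dist c p" using far by blast
  then show ?thesis
  proof cases
    case 1
    have "\<exists>p. \<forall>n. p n \<noteq> c \<and> dist c (p (Suc n)) < s^6 * dist c (p n)"
      by (rule dependent_nat_choice) (use 1 s in \<open>auto intro: zero_less_one\<close>)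
    then obtain p where p: "\<And>n. p n \<noteq> c" "\<And>n. dist c (p (Suc n)) < s^6 * dist c (p n)" by blast
    have "dist c (p (Suc n)) \<le> dist c (p n)" for n
      using p(2)[of n] mult_right_mono[of "s^6" 1 "dist c (p n)"] s6 by simp
    then have dec: "decseq (\<lambda>n. dist c (p n))" by (simp add: decseq_Suc_iff)
    have "dist c (p n) < s^6 * dist c (p m)" if "m < n" for m n
      using decseqD[OF dec, of "Suc m" n] p(2)[of m] that by simp
    then show ?thesis using p(1) disj[of p] by metis
  next
    case 2
    have "\<exists>p. \<forall>n. p n \<noteq> c \<and> dist c (p n) < s^6 * dist c (p (Suc n))"
    proof (rule dependent_nat_choice)
      show "\<exists>p. p \<noteq> c" using 2[rule_format, of 0] by auto
      fix x :: 'm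
      obtain q where "dist c x / s^6 < dist c q" using 2 by blast
      then have "dist c x < s^6 * dist c q" using s by (simp add: divide_less_eq mult.commute)
      moreover from this have "q \<noteq> c" using s by (auto simp: not_less)
      ultimately show "\<exists>y. y \<noteq> c \<and> dist c x < s^6 * dist c y" by blast
    qed
    then obtain p where p: "\<And>n. p n \<noteq> c" "\<And>n. dist c (p n) < s^6 * dist c (p (Suc n))" by blast
    have "dist c (p n) \<le> dist c (p (Suc n))" for n
      using p(2)[of n] mult_right_mono[of "s^6" 1 "dist c (p (Suc n))"] s6 by simp
    then have inc: "incseq (\<lambda>n. dist c (p n))" by (simp add: incseq_Suc_iff)
    have "dist c (p m) < s^6 * dist c (p n)" if "m < n" for m n
    proof -
      have "dist c (p m) < s^6 * dist c (p (Suc m))" by (rule p)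
      also have "\<dots> \<le> s^6 * dist c (p n)"
        using incseqD[OF inc, of "Suc m" n] that s6 by (intro mult_left_mono) auto
      finally show ?thesis .
    qed
    then show ?thesis using p(1) disj[of p] by metis
  qed
qed

text \<open>Pick pairs \<open>(c n, p n)\<close> of distinct points with distance tending to \<open>0\<close>. By the hypothesis the \<open>c n\<close>
form a totally bounded set, hence a relatively compact one as the space is complete. A subsequence of
the \<open>c n\<close> converges, the corresponding \<open>p n\<close> have the same limit, and one point of each pair differs
from it.\<close>

lemma limit_point_of_totally_bounded_close_pairs:
  assumes nud: "\<not> uniform_discrete (UNIV :: 'm::complete_space set)"
    and tb: "\<forall>e>0. \<exists>\<rho>>0. \<exists>K. finite K \<and>
      {c::'m::complete_space. \<exists>p. p \<noteq> c \<and> dist c p < \<rho>} \<subseteq> (\<Union>x\<in>K. ball x e)"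
  obtains l :: "'m::complete_space" where "\<forall>e>0. \<exists>q. q \<noteq> l \<and> dist l q < e"
proof -
  define C where "C \<rho> = {c::'m. \<exists>p. p \<noteq> c \<and> dist c p < \<rho>}" for \<rho>
  have "\<exists>c p :: 'm. p \<noteq> c \<and> dist c p < inverse (real (Suc n))" for n
  proof (rule ccontr)
    assume "\<nexists>c p :: 'm. p \<noteq> c \<and> dist c p < inverse (real (Suc n))"
    then have "\<forall>x\<in>UNIV. \<forall>y\<in>UNIV. dist x (y :: 'm) < inverse (real (Suc n)) \<longrightarrow> x = y" by metis
    moreover have "0 < inverse (real (Suc n))" by simp
    ultimately show False using nud unfolding uniform_discrete_def by blast
  qed
  then obtain c p :: "nat \<Rightarrow> 'm" where cp: "\<And>n. p n \<noteq> c n" "\<And>n. dist (c n) (p n) < inverse (real (Suc n))"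
    by metis
  have "compact (closure (range c))"
    unfolding compact_eq_totally_bounded
  proof (intro conjI allI impI)
    show "complete (closure (range c))" by (simp add: complete_eq_closed)
    fix e :: real assume e: "0 < e"
    then obtain \<rho> K where K: "0 < \<rho>" "finite K" "C \<rho> \<subseteq> (\<Union>x\<in>K. ball x (e/2))"
      using tb[rule_format, of "e/2"] unfolding C_def by auto
    obtain N where N: "inverse (real (Suc N)) < \<rho>" using K(1) reals_Archimedean by blast
    have cC: "c n \<in> C \<rho>" if "N \<le> n" for n
    proof -
      have "inverse (real (Suc n)) \<le> inverse (real (Suc N))" using that by simp
      then have "dist (c n) (p n) < \<rho>" using cp(2)[of n] N by linarith
      then show ?thesis using cp(1)[of n] unfolding C_def by blast
    qed
    have "range c \<subseteq> (\<Union>x\<in>K \<union> c ` {..<N}. cball x (e/2))"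
    proof
      fix x assume "x \<in> range c"
      then obtain n where n: "x = c n" by blast
      show "x \<in> (\<Union>x\<in>K \<union> c ` {..<N}. cball x (e/2))"
      proof (cases "n < N")
        case False
        then have "c n \<in> (\<Union>x\<in>K. ball x (e/2))" using subsetD[OF K(3) cC[of n]] by simp
        then show ?thesis using n by force
      next
        case True
        then have "c n \<in> c ` {..<N}" "c n \<in> cball (c n) (e/2)" using e by auto
        then show ?thesis unfolding n by (intro UN_I[of "c n"] UnI2)
      qed
    qed
    moreover have "closed (\<Union>x\<in>K \<union> c ` {..<N}. cball x (e/2))"
      using K(2) by (intro closed_UN) auto
    ultimately have "closure (range c) \<subseteq> (\<Union>x\<in>K \<union> c ` {..<N}. cball x (e/2))"
      by (rule closure_minimal)
    also have "\<dots> \<subseteq> (\<Union>x\<in>K \<union> c ` {..<N}. ball x e)" using e by (intro UN_mono) auto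
    finally show "\<exists>k. finite k \<and> closure (range c) \<subseteq> (\<Union>x\<in>k. ball x e)"
      using K(2) by (intro exI[of _ "K \<union> c ` {..<N}"]) simp
  qed
  then have "seq_compact (closure (range c))" by (simp add: compact_eq_seq_compact_metric)
  moreover have "\<forall>n. c n \<in> closure (range c)" using closure_subset[of "range c"] by blast
  ultimately obtain l r where l: "strict_mono (r :: nat \<Rightarrow> nat)" "(c \<circ> r) \<longlonglongrightarrow> l"
    unfolding seq_compact_def by blast
  have "(\<lambda>n. inverse (real (Suc (r n)))) \<longlonglongrightarrow> 0"
    using LIMSEQ_subseq_LIMSEQ[OF LIMSEQ_inverse_real_of_nat l(1)] by (simp add: o_def)
  show ?thesis
  proof (rule that, intro allI impI)
    fix e :: real assume e: "0 < e"
    have "\<forall>\<^sub>F n in sequentially. dist (c (r n)) l < e/2"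
      using tendstoD[OF l(2), of "e/2"] e by (simp add: o_def)
    moreover have "\<forall>\<^sub>F n in sequentially. inverse (real (Suc (r n))) < e/2"
      by (rule order_tendstoD) (fact, use e in simp)
    ultimately have "\<forall>\<^sub>F n in sequentially. dist (c (r n)) l < e/2 \<and> inverse (real (Suc (r n))) < e/2"
      by (rule eventually_conj)
    then obtain n where n: "dist (c (r n)) l < e/2" "inverse (real (Suc (r n))) < e/2"
      by (auto simp: eventually_sequentially)
    have "dist l (p (r n)) < e"
      using n cp(2)[of "r n"] dist_triangle[of l "p (r n)" "c (r n)"] by (simp add: dist_commute)
    moreover have "dist l (c (r n)) < e" using n(1) e by (simp add: dist_commute)
    ultimately show "\<exists>q. q \<noteq> l \<and> dist l q < e" using cp(1)[of "r n"] by metis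
  qed
qed

text \<open>If the space is unbounded, any point serves as a common centre. If close pairs accumulate somewhere,
the accumulation point does. Otherwise there is \<open>e\<close> such that, for every \<open>\<rho> > 0\<close>, the points with a neighbour
at distance less than \<open>\<rho>\<close> cannot be covered by finitely many balls of radius \<open>e\<close>. Then one can select
greedily infinitely many such points at mutual distance at least \<open>e\<close>, and for small \<open>\<rho>\<close> the annulus
at each of them stays within distance \<open>e / 2\<close> of its centre.\<close>

lemma disjoint_annuli_exist:
  assumes s: "0 < s" "s \<le> 1/2"
    and M: "\<not> bounded (UNIV :: 'm::complete_space set) \<or> \<not> uniform_discrete (UNIV :: 'm::complete_space set)"
  obtains c p :: "nat \<Rightarrow> 'm::complete_space" where "\<And>n. c n \<noteq> p n"
    "disjoint_family (\<lambda>n. annulus s (c n) (p n))"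
proof -
  note result = that
  have common: ?thesis
    if far: "(\<forall>e>0. \<exists>p. p \<noteq> l \<and> dist l p < e) \<or> (\<forall>e. \<exists>p. e < dist l p)" for l :: 'm
  proof -
    obtain p :: "nat \<Rightarrow> 'm" where "\<And>n. l \<noteq> p n" "disjoint_family (\<lambda>n. annulus s l (p n))"
      using disjoint_annuli_common_centre[OF s far] by blast
    then show ?thesis by (rule result[of "\<lambda>_. l"])
  qed
  show ?thesis
  proof (cases "bounded (UNIV :: 'm set)")
    case False
    obtain c :: 'm where True by blast
    have "\<exists>p. e < dist c p" for e
      using False unfolding bounded_any_center[of _ c] by (auto simp: not_le)
    then show ?thesis by (intro common) auto
  next
    case True
    then have nud: "\<not> uniform_discrete (UNIV :: 'm set)" using M by simp
    define C where "C \<rho> = {c::'m. \<exists>p. p \<noteq> c \<and> dist c p < \<rho>}" for \<rho>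
    show ?thesis
    proof (cases "\<forall>e>0. \<exists>\<rho>>0. \<exists>K. finite K \<and> C \<rho> \<subseteq> (\<Union>x\<in>K. ball x e)")
      case True
      then obtain l :: 'm where "\<forall>e>0. \<exists>q. q \<noteq> l \<and> dist l q < e"
        unfolding C_def by (rule limit_point_of_totally_bounded_close_pairs[OF nud])
      then show ?thesis by (intro common[of l]) simp
    next
      case False
      then obtain e where e: "0 < e" "\<And>\<rho> K. 0 < \<rho> \<Longrightarrow> finite K \<Longrightarrow> \<not> C \<rho> \<subseteq> (\<Union>x\<in>K. ball x e)"
        by blast
      \<comment> \<open>The outer radius of an annulus of scale below \<open>\<rho>\<close> is then less than \<open>e / 2\<close>.\<close>
      define \<rho> where "\<rho> = s^3 * e / 2"
      have \<rho>: "0 < \<rho>" using s e by (simp add: \<rho>_def)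
      have "\<exists>c :: nat \<Rightarrow> 'm. \<forall>n. c n \<in> C \<rho> \<and> (\<forall>m<n. e \<le> dist (c m) (c n))"
      proof (rule dependent_wellorder_choice)
        fix n and c :: "nat \<Rightarrow> 'm"
        obtain x where "x \<in> C \<rho>" "x \<notin> (\<Union>y\<in>c ` {..<n}. ball y e)"
          using e(2)[OF \<rho>, of "c ` {..<n}"] by blast
        then show "\<exists>x. x \<in> C \<rho> \<and> (\<forall>m<n. e \<le> dist (c m) x)" by (auto simp: not_less)
      qed simp
      then obtain c :: "nat \<Rightarrow> 'm" where c: "\<And>n. c n \<in> C \<rho>" "\<And>m n. m < n \<Longrightarrow> e \<le> dist (c m) (c n)" by blast
      then obtain p where p: "\<And>n. p n \<noteq> c n" "\<And>n. dist (c n) (p n) < \<rho>"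
        unfolding C_def by simp metis
      have near: "dist x (c n) < e / 2" if "x \<in> annulus s (c n) (p n)" for x n
      proof -
        have "s^3 * dist x (c n) < s^3 * (e / 2)"
          using that p(2)[of n] by (simp add: annulus_def \<rho>_def)
        then show ?thesis using s by simp
      qed
      have False if "x \<in> annulus s (c m) (p m)" "x \<in> annulus s (c n) (p n)" "m < n" for x m n
        using near[OF that(1)] near[OF that(2)] c(2)[OF that(3)] dist_triangle3[of "c m" "c n" x] by simp
      then have "disjoint_family (\<lambda>n. annulus s (c n) (p n))"
        unfolding disjoint_family_on_def disjoint_iff by (metis linorder_neqE_nat)
      then show ?thesis using p(1) that[of c p] by metis
    qed
  qed
qed

text \<open>A given point, later the origin, lies in at most one annulus of a disjoint sequence; so it suffices to
drop an initial part of the sequence.\<close>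

lemma disjoint_annuli_avoiding_exist:
  fixes z :: "'m::complete_space"
  assumes s: "0 < s" "s \<le> 1/2"
    and M: "\<not> bounded (UNIV :: 'm set) \<or> \<not> uniform_discrete (UNIV :: 'm set)"
  obtains c p :: "nat \<Rightarrow> 'm" where "\<And>n. c n \<noteq> p n"
    "disjoint_family (\<lambda>n. annulus s (c n) (p n))" "\<And>n. z \<notin> annulus s (c n) (p n)"
proof -
  obtain c p :: "nat \<Rightarrow> 'm" where cp: "\<And>n. c n \<noteq> p n"
    and disj: "disjoint_family (\<lambda>n. annulus s (c n) (p n))"
    using disjoint_annuli_exist[OF s M] by blast
  obtain k where k: "\<And>n. k \<le> n \<Longrightarrow> z \<notin> annulus s (c n) (p n)"
  proof (cases "\<exists>m. z \<in> annulus s (c m) (p m)")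
    case True
    then obtain m where "z \<in> annulus s (c m) (p m)" by blast
    then have "z \<notin> annulus s (c n) (p n)" if "Suc m \<le> n" for n
      using disj that unfolding disjoint_family_on_def disjoint_iff
      by (metis Suc_n_not_le_n UNIV_I)
    then show ?thesis using that by blast
  qed blast
  show ?thesis
  proof (rule that)
    show "disjoint_family (\<lambda>n. annulus s (c (n + k)) (p (n + k)))"
      using disj by (auto simp: disjoint_family_on_def)
  qed (use cp k in auto)
qed

section \<open>The symmetric strong diameter two property of the Lipschitz space\<close>

lemma blinfun_almost_norming:
  fixes F :: "'z::real_normed_vector dual"
  assumes "a < norm F" "0 \<le> a"
  obtains z where "norm z \<le> 1" "a < blinfun_apply F z"
proof -
  have "\<exists>z. a * norm z < norm (blinfun_apply F z)"
    using norm_blinfun_bound[of a F] assms by (meson not_le)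
  then obtain z where z: "a * norm z < \<bar>blinfun_apply F z\<bar>" by auto
  then have nz: "0 < norm z" by (cases "z = 0") auto
  define w where "w = (sgn (blinfun_apply F z) / norm z) *\<^sub>R z"
  have "norm w \<le> 1" using nz by (simp add: w_def sgn_if)
  moreover have "blinfun_apply F w = \<bar>blinfun_apply F z\<bar> / norm z"
    by (simp add: w_def blinfun.scaleR_right abs_sgn mult.commute)
  then have "a < blinfun_apply F w" using z nz by (simp add: less_divide_eq)
  ultimately show ?thesis using that by blast
qed

lemma slice_nonempty:
  assumes "norm F = 1" "0 < \<alpha>"
  shows "slice F \<alpha> \<noteq> {}"
proof -
  obtain z where "norm z \<le> 1" "max 0 (1 - \<alpha>) < blinfun_apply F z"
    using blinfun_almost_norming[of "max 0 (1 - \<alpha>)" F] assms by auto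
  then have "z \<in> slice F \<alpha>" by (simp add: slice_def)
  then show ?thesis by blast
qed

text \<open>Each slice contains some \<open>f i\<close> of norm at most \<open>1 - 2 s\<close> for a common small \<open>s\<close>. Perturb the \<open>f i\<close> on
a disjoint sequence of annuli, obtaining \<open>g i n\<close> and \<open>\<phi> n\<close>. Both \<open>g i n - f i\<close> and \<open>\<phi> n\<close> are weakly
null in \<open>n\<close>, so \<open>g i n\<close> and \<open>g i n \<plusminus> \<phi> n\<close> lie in the finitely many given slices once \<open>n\<close> is large.\<close>

lemma SSD2P_lip0:
  assumes nz: "\<exists>x::'x::real_normed_vector. x \<noteq> 0"
    and CEP: "CEP TYPE('m::{pointed_metric_space, complete_space}) TYPE('x)"
    and M: "\<not> bounded (UNIV :: 'm set) \<or> \<not> uniform_discrete (UNIV :: 'm set)"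
  shows "SSD2P TYPE(('m, 'x) lip0)"
  unfolding SSD2P_def
proof (intro allI impI)
  fix k :: nat and S :: "nat \<Rightarrow> ('m, 'x) lip0 set" and \<epsilon> :: real
  assume S: "\<forall>i\<in>{1..k}. S i \<in> ball_slices" and \<epsilon>: "\<epsilon> > 0"
  obtain e :: 'x where e: "norm e = 1"
    using nz by (metis norm_sgn)
  have "\<forall>i\<in>{1..k}. \<exists>F \<alpha>. S i = slice F \<alpha> \<and> norm F = 1 \<and> \<alpha> > 0"
    using S unfolding ball_slices_def by blast
  then obtain F \<alpha> where F: "\<And>i. i \<in> {1..k} \<Longrightarrow> S i = slice (F i) (\<alpha> i)"
    "\<And>i. i \<in> {1..k} \<Longrightarrow> norm (F i) = 1" "\<And>i. i \<in> {1..k} \<Longrightarrow> \<alpha> i > 0"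
    by metis
  have "\<exists>u. norm u \<le> 1 \<and> blinfun_apply (F i) u > 1 - \<alpha> i" if "i \<in> {1..k}" for i
    using slice_nonempty[OF F(2,3)[OF that]] by (auto simp: slice_def)
  then obtain u where u: "\<And>i. i \<in> {1..k} \<Longrightarrow> norm (u i) \<le> 1"
    "\<And>i. i \<in> {1..k} \<Longrightarrow> blinfun_apply (F i) (u i) > 1 - \<alpha> i"
    by metis
  have "\<forall>\<^sub>F s in at_right 0. \<forall>i\<in>{1..k}. 1 - \<alpha> i < (1 - 2 * s) * blinfun_apply (F i) (u i)"
  proof (rule eventually_ball_finite, simp, rule ballI)
    fix i assume i: "i \<in> {1..k}"
    have "((\<lambda>s. (1 - 2 * s) * blinfun_apply (F i) (u i)) \<longlongrightarrow> (1 - 2 * 0) * blinfun_apply (F i) (u i)) (at_right 0)"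
      by (intro tendsto_intros)
    then show "\<forall>\<^sub>F s in at_right 0. 1 - \<alpha> i < (1 - 2 * s) * blinfun_apply (F i) (u i)"
      by (rule order_tendstoD) (use u(2)[OF i] in simp)
  qed
  moreover have "\<forall>\<^sub>F s in at_right (0::real). 0 < s \<and> s < 1/2 \<and> s < \<epsilon>"
    by (rule eventually_mono[OF eventually_at_right_real[of 0 "min (1/2) \<epsilon>"]]) (use \<epsilon> in auto)
  ultimately have "\<forall>\<^sub>F s in at_right (0::real).
      (\<forall>i\<in>{1..k}. 1 - \<alpha> i < (1 - 2 * s) * blinfun_apply (F i) (u i)) \<and> 0 < s \<and> s < 1/2 \<and> s < \<epsilon>"
    by (rule eventually_conj)
  then obtain s where s: "0 < s" "s < 1/2" "s < \<epsilon>"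
    and su: "\<And>i. i \<in> {1..k} \<Longrightarrow> 1 - \<alpha> i < (1 - 2 * s) * blinfun_apply (F i) (u i)"
    using eventually_happens'[OF trivial_limit_at_right_real] by blast
  define f where "f i = (1 - 2 * s) *\<^sub>R u i" for i
  have f: "norm (f i) \<le> 1 - 2 * s" "1 - \<alpha> i < blinfun_apply (F i) (f i)" if "i \<in> {1..k}" for i
    using mult_left_mono[OF u(1)[OF that], of "1 - 2 * s"] su[OF that] s
    by (simp_all add: f_def blinfun.scaleR_right)
  have s': "s \<le> 1/2" using s by simp
  obtain c p :: "nat \<Rightarrow> 'm" where cp: "\<And>n. c n \<noteq> p n"
    and disj: "disjoint_family (\<lambda>n. annulus s (c n) (p n))"
    and orig: "\<And>n. origin \<notin> annulus s (c n) (p n)"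
    using disjoint_annuli_avoiding_exist[OF s(1) s' M] by blast
  define U where "U n = annulus s (c n) (p n)" for n
  have "\<exists>\<phi> :: ('m, 'x) lip0. 1 - s \<le> norm \<phi> \<and> norm \<phi> \<le> 1 \<and> (\<forall>x. x \<notin> U n \<longrightarrow> lip0_apply \<phi> x = 0) \<and>
      (\<forall>f. norm f \<le> 1 - 2 * s \<longrightarrow> (\<exists>g. norm g \<le> 1 \<and> norm (g + \<phi>) \<le> 1 \<and> norm (g - \<phi>) \<le> 1 \<and>
       (\<forall>x. x \<notin> U n \<longrightarrow> lip0_apply g x = lip0_apply f x)))" for n
    unfolding U_def
    by (rule lip0_perturbation[OF CEP s(1) s' cp[of n] orig[of n] e]) blast
  then obtain \<phi> :: "nat \<Rightarrow> ('m, 'x) lip0" where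
    \<phi>: "\<And>n. 1 - s \<le> norm (\<phi> n)" "\<And>n. norm (\<phi> n) \<le> 1" "\<And>n x. x \<notin> U n \<Longrightarrow> lip0_apply (\<phi> n) x = 0"
    and ex_g: "\<And>n f. norm f \<le> 1 - 2 * s \<Longrightarrow> \<exists>g. norm g \<le> 1 \<and> norm (g + \<phi> n) \<le> 1 \<and> norm (g - \<phi> n) \<le> 1 \<and>
       (\<forall>x. x \<notin> U n \<longrightarrow> lip0_apply g x = lip0_apply f x)"
    by metis
  have "\<forall>i\<in>{1..k}. \<forall>n. \<exists>g. norm g \<le> 1 \<and> norm (g + \<phi> n) \<le> 1 \<and> norm (g - \<phi> n) \<le> 1 \<and>
       (\<forall>x. x \<notin> U n \<longrightarrow> lip0_apply g x = lip0_apply (f i) x)"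
    using ex_g f(1) by blast
  then obtain g where
    g: "\<And>i n. i \<in> {1..k} \<Longrightarrow> norm (g i n) \<le> 1" "\<And>i n. i \<in> {1..k} \<Longrightarrow> norm (g i n + \<phi> n) \<le> 1"
      "\<And>i n. i \<in> {1..k} \<Longrightarrow> norm (g i n - \<phi> n) \<le> 1"
      "\<And>i n x. i \<in> {1..k} \<Longrightarrow> x \<notin> U n \<Longrightarrow> lip0_apply (g i n) x = lip0_apply (f i) x"
    by metis
  have "\<forall>\<^sub>F n in sequentially. \<forall>i\<in>{1..k}.
      1 - \<alpha> i < blinfun_apply (F i) (g i n) \<and> 1 - \<alpha> i < blinfun_apply (F i) (g i n + \<phi> n) \<and>
      1 - \<alpha> i < blinfun_apply (F i) (g i n - \<phi> n)"
  proof (rule eventually_ball_finite, simp, rule ballI)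
    fix i assume i: "i \<in> {1..k}"
    have disjU: "disjoint_family U" using disj by (simp add: U_def[abs_def])
    have h: "norm (g i n - f i) \<le> 2" for n
      using norm_triangle_ineq4[of "g i n" "f i"] g(1)[OF i, of n] f(1)[OF i] s by simp
    have "(\<lambda>n. blinfun_apply (F i) (g i n - f i)) \<longlonglongrightarrow> 0"
      by (rule disjoint_supports_weakly_null[OF h disjU]) (simp add: minus_lip0.rep_eq g(4)[OF i])
    then have "(\<lambda>n. blinfun_apply (F i) (g i n - f i) + blinfun_apply (F i) (f i))
        \<longlonglongrightarrow> 0 + blinfun_apply (F i) (f i)"
      by (intro tendsto_intros)
    then have 1: "(\<lambda>n. blinfun_apply (F i) (g i n)) \<longlonglongrightarrow> blinfun_apply (F i) (f i)"
      by (simp add: blinfun.diff_right)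
    have 2: "(\<lambda>n. blinfun_apply (F i) (\<phi> n)) \<longlonglongrightarrow> 0"
      by (rule disjoint_supports_weakly_null[OF \<phi>(2) disjU \<phi>(3)])
    show "\<forall>\<^sub>F n in sequentially. 1 - \<alpha> i < blinfun_apply (F i) (g i n) \<and>
        1 - \<alpha> i < blinfun_apply (F i) (g i n + \<phi> n) \<and> 1 - \<alpha> i < blinfun_apply (F i) (g i n - \<phi> n)"
      using order_tendstoD(1)[OF 1, of "1 - \<alpha> i"] order_tendstoD(1)[OF tendsto_add[OF 1 2], of "1 - \<alpha> i"]
        order_tendstoD(1)[OF tendsto_diff[OF 1 2], of "1 - \<alpha> i"] f(2)[OF i]
      by (auto simp: blinfun.add_right blinfun.diff_right intro!: eventually_conj)
  qed
  then obtain n where n: "\<forall>i\<in>{1..k}.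
      1 - \<alpha> i < blinfun_apply (F i) (g i n) \<and> 1 - \<alpha> i < blinfun_apply (F i) (g i n + \<phi> n) \<and>
      1 - \<alpha> i < blinfun_apply (F i) (g i n - \<phi> n)"
    by (auto simp: eventually_sequentially)
  show "\<exists>x \<phi>. (\<forall>i\<in>{1..k}. x i \<in> S i) \<and> \<phi> \<in> cball 0 1 \<and> norm \<phi> > 1 - \<epsilon> \<and>
           (\<forall>i\<in>{1..k}. x i + \<phi> \<in> S i \<and> x i - \<phi> \<in> S i)"
  proof (intro exI conjI ballI)
    show "\<phi> n \<in> cball 0 1" using \<phi>(2) by simp
    show "norm (\<phi> n) > 1 - \<epsilon>" using \<phi>(1)[of n] s(3) by linarith
  next
    fix i assume i: "i \<in> {1..k}"
    show "g i n \<in> S i" "g i n + \<phi> n \<in> S i" "g i n - \<phi> n \<in> S i"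
      using n i g(1-3)[OF i, of n] by (auto simp: F(1)[OF i] slice_def)
  qed
qed

section \<open>Unit spheres of finite-dimensional subspaces\<close>

text \<open>Bolzano-Weierstrass in the span of a finite set, by induction on the set. The induction hypothesis
makes \<open>span B\<close> closed, so a new vector \<open>b\<close> has positive distance from \<open>span B\<close>. Therefore the
coefficients of \<open>b\<close> along a bounded sequence are bounded, and after passing to a subsequence both they
and the components in \<open>span B\<close> converge.\<close>

lemma bounded_sequence_in_span_finite:
  fixes B :: "'z::real_normed_vector set"
  assumes "finite B" "\<And>n::nat. x n \<in> span B" "bounded (range x)"
  shows "\<exists>l\<in>span B. \<exists>r. strict_mono (r :: nat \<Rightarrow> nat) \<and> (x \<circ> r) \<longlonglongrightarrow> l"
  using assms
proof (induction B arbitrary: x rule: finite_induct)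
  case empty
  then have "x = (\<lambda>_. 0)" by auto
  then show ?case by (intro bexI[of _ 0] exI[of _ id]) (auto simp: o_def strict_mono_def)
next
  case (insert b B)
  have closed: "closed (span B)"
    unfolding closed_sequential_limits
  proof (intro allI impI, elim conjE)
    fix y l assume y: "\<forall>n. y n \<in> span B" "y \<longlonglongrightarrow> l"
    have "bounded (range y)" using y(2) convergent_imp_bounded by blast
    then obtain l' r where "l' \<in> span B" "strict_mono r" "(y \<circ> r) \<longlonglongrightarrow> l'"
      using insert.IH[of y] y(1) by blast
    then show "l \<in> span B" using LIMSEQ_subseq_LIMSEQ[OF y(2)] LIMSEQ_unique by blast
  qed
  show ?case
  proof (cases "b \<in> span B")
    case True
    then have "span (insert b B) = span B" by (rule span_redundant)
    then show ?thesis using insert.IH insert.prems by simp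
  next
    case False
    have "\<forall>n. \<exists>t. x n - t *\<^sub>R b \<in> span B"
      using insert.prems(1) span_breakdown_eq by blast
    then obtain t where t: "\<And>n. x n - t n *\<^sub>R b \<in> span B" by metis
    obtain d where d: "0 < d" "\<And>y. y \<in> span B \<Longrightarrow> d \<le> dist b y"
    proof -
      obtain d where "0 < d" "ball b d \<subseteq> - span B"
        using openE[of "- span B" b] closed False by (auto simp: closed_def)
      then show ?thesis using that[of d] by (auto simp: not_less[symmetric] subset_iff)
    qed
    have bound: "d * \<bar>t n\<bar> \<le> norm (x n)" for n
    proof (cases "t n = 0")
      case False
      define y where "y = (- 1 / t n) *\<^sub>R (x n - t n *\<^sub>R b)"
      have "b - y = (1 / t n) *\<^sub>R x n" using False by (simp add: y_def algebra_simps)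
      moreover have "y \<in> span B" unfolding y_def by (rule span_scale) (rule t)
      ultimately have "d \<le> norm (x n) / \<bar>t n\<bar>" using d(2)[of y] by (simp add: dist_norm)
      then show ?thesis using False by (simp add: field_simps)
    qed simp
    obtain R where R: "\<And>n. norm (x n) \<le> R"
      using insert.prems(2) by (auto simp: bounded_iff)
    have tR: "\<bar>t n\<bar> \<le> R / d" for n
      using order_trans[OF bound R, of n] d(1) by (simp add: field_simps)
    then have "bounded (range t)" by (auto simp: bounded_iff)
    then obtain t0 r where r: "strict_mono (r :: nat \<Rightarrow> nat)" "(t \<circ> r) \<longlonglongrightarrow> t0"
      using bounded_imp_convergent_subsequence by blast
    define y where "y n = x (r n) - t (r n) *\<^sub>R b" for n
    have "norm (y n) \<le> R + R / d * norm b" for n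
      using norm_triangle_ineq4[of "x (r n)" "t (r n) *\<^sub>R b"] R[of "r n"]
        mult_right_mono[OF tR[of "r n"], of "norm b"] by (simp add: y_def)
    then have "bounded (range y)" by (auto simp: bounded_iff)
    then obtain y0 q where q: "y0 \<in> span B" "strict_mono (q :: nat \<Rightarrow> nat)" "(y \<circ> q) \<longlonglongrightarrow> y0"
      using insert.IH[of y] t unfolding y_def by blast
    have "(\<lambda>n. (y \<circ> q) n + ((t \<circ> r) \<circ> q) n *\<^sub>R b) \<longlonglongrightarrow> y0 + t0 *\<^sub>R b"
      by (intro tendsto_intros q LIMSEQ_subseq_LIMSEQ[OF r(2) q(2)])
    also have "(\<lambda>n. (y \<circ> q) n + ((t \<circ> r) \<circ> q) n *\<^sub>R b) = x \<circ> (r \<circ> q)"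
      by (auto simp: y_def)
    finally have lim: "(x \<circ> (r \<circ> q)) \<longlonglongrightarrow> y0 + t0 *\<^sub>R b" .
    have "y0 \<in> span (insert b B)" using span_mono[of B "insert b B"] q(1) by blast
    then have "y0 + t0 *\<^sub>R b \<in> span (insert b B)"
      by (intro span_add span_scale) (simp_all add: span_base)
    then show ?thesis using strict_mono_o[OF r(1) q(2)] lim by blast
  qed
qed

lemma finite_net_of_unit_sphere:
  fixes B :: "'z::real_normed_vector set"
  assumes "finite B" "0 < \<eta>"
  obtains K where "finite K" "\<And>x. x \<in> K \<Longrightarrow> norm x = 1"
    "\<And>x. x \<in> span B \<Longrightarrow> norm x = 1 \<Longrightarrow> \<exists>k\<in>K. norm (x - k) < \<eta>"
proof -
  define S where "S = {x \<in> span B. norm x = 1}"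
  have "seq_compact S"
    unfolding seq_compact_def
  proof (intro allI impI)
    fix x :: "nat \<Rightarrow> 'z" assume x: "\<forall>n. x n \<in> S"
    have "bounded (range x)" using x by (auto simp: bounded_iff S_def)
    then obtain l r where l: "l \<in> span B" "strict_mono (r :: nat \<Rightarrow> nat)" "(x \<circ> r) \<longlonglongrightarrow> l"
      using bounded_sequence_in_span_finite[OF assms(1), of x] x by (auto simp: S_def)
    have "(\<lambda>n. norm ((x \<circ> r) n)) \<longlonglongrightarrow> norm l" by (intro tendsto_intros l)
    moreover have "(\<lambda>n. norm ((x \<circ> r) n)) = (\<lambda>_. 1)" using x by (auto simp: S_def)
    ultimately have "norm l = 1" by (simp add: LIMSEQ_const_iff)
    then show "\<exists>l\<in>S. \<exists>r. strict_mono r \<and> (x \<circ> r) \<longlonglongrightarrow> l" using l by (auto simp: S_def)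
  qed
  then have "compact S" by (simp add: compact_eq_seq_compact_metric)
  then obtain K where K: "K \<subseteq> S" "finite K" "S \<subseteq> (\<Union>x\<in>K. ball x \<eta>)"
  proof -
    have "S \<subseteq> (\<Union>x\<in>S. ball x \<eta>)" using assms(2) by auto
    then show ?thesis using compactE_image[OF \<open>compact S\<close>, of S "\<lambda>x. ball x \<eta>"] that by auto
  qed
  show ?thesis
  proof (rule that[of K])
    show "finite K" "\<And>x. x \<in> K \<Longrightarrow> norm x = 1" using K by (auto simp: S_def)
    fix x assume "x \<in> span B" "norm x = 1"
    then have "x \<in> S" by (simp add: S_def)
    then obtain k where "k \<in> K" "x \<in> ball k \<eta>" using K(3) by blast
    then show "\<exists>k\<in>K. norm (x - k) < \<eta>"
      by (intro bexI[of _ k]) (simp_all add: dist_norm norm_minus_commute)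
  qed
qed

section \<open>From the symmetric strong diameter two property to octahedrality\<close>

lift_definition evaluation :: "'w::real_normed_vector \<Rightarrow> 'w dual dual"
  is "\<lambda>w f. blinfun_apply f w"
  by (rule blinfun.bounded_linear_left)

lemma norm_evaluation_le: "norm (evaluation w) \<le> norm w"
proof (rule norm_blinfun_bound)
  show "norm (blinfun_apply (evaluation w) f) \<le> norm w * norm f" for f
    using norm_blinfun[of f w] by (simp add: evaluation.rep_eq mult.commute)
qed simp

text \<open>In a dual space an almost norming functional can be taken to be a normalised evaluation.\<close>

lemma norming_functional_on_dual:
  fixes \<phi> :: "'w::real_normed_vector dual"
  assumes "a < norm \<phi>" "0 \<le> a"
  obtains F :: "'w dual dual" where "norm F = 1" "a < blinfun_apply F \<phi>"
proof -
  obtain w where w: "norm w \<le> 1" "a < blinfun_apply \<phi> w"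
    using blinfun_almost_norming[OF assms] by blast
  define E where "E = evaluation w"
  have E: "norm E \<le> 1" "a < blinfun_apply E \<phi>"
    using w norm_evaluation_le[of w] by (auto simp: E_def evaluation.rep_eq)
  then have "0 < norm E" using assms(2) by auto
  have "blinfun_apply E \<phi> * norm E \<le> blinfun_apply E \<phi>"
    using E assms(2) by (intro mult_left_le) auto
  then have "blinfun_apply E \<phi> \<le> blinfun_apply E \<phi> / norm E"
    using \<open>0 < norm E\<close> by (simp add: le_divide_eq)
  then have "a < blinfun_apply (sgn E) \<phi>"
    using E(2) by (simp add: sgn_div_norm scaleR_blinfun.rep_eq divide_inverse mult.commute)
  moreover have "norm (sgn E) = 1" using \<open>0 < norm E\<close> by (simp add: norm_sgn)
  ultimately show ?thesis using that by blast
qed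

lemma SSD2PD:
  fixes S :: "nat \<Rightarrow> 'z::real_normed_vector set"
  assumes "SSD2P TYPE('z)" "1 \<le> k" "\<forall>i\<in>{1..k}. S i \<in> ball_slices" "0 < \<epsilon>"
  obtains x \<phi> where "norm \<phi> \<le> 1" "1 - \<epsilon> < norm \<phi>" "\<forall>i\<in>{1..k}. x i \<in> S i"
    "\<forall>i\<in>{1..k}. x i + \<phi> \<in> S i \<and> x i - \<phi> \<in> S i"
  using assms unfolding SSD2P_def mem_cball_0 by blast

text \<open>Let \<open>f i\<close> run through a finite net of the unit sphere of \<open>E\<close>. The property gives points \<open>x i\<close> and some
\<open>\<phi>\<close> almost of norm one such that \<open>f i\<close> is almost one at \<open>x i + \<phi>\<close> and at \<open>x i - \<phi>\<close>, which lie in the unit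
ball. Let \<open>F\<close> almost norm \<open>\<phi>\<close>. From \<open>\<bar>F (x i)\<bar> + F \<phi> \<le> 1\<close> it follows that \<open>F\<close> is small at \<open>x i\<close>,
hence almost \<open>1\<close> at \<open>x i + \<phi>\<close> and almost \<open>-1\<close> at \<open>x i - \<phi>\<close>. Testing \<open>f i + t F\<close> at \<open>x i + \<phi>\<close> if
\<open>t \<ge> 0\<close>, and at \<open>x i - \<phi>\<close> otherwise, shows that its norm is almost \<open>1 + \<bar>t\<bar>\<close>.\<close>

lemma SSD2P_imp_octahedral_dual:
  assumes SSD2P: "SSD2P TYPE('w::real_normed_vector dual)" and nz: "\<exists>f::'w dual. f \<noteq> 0"
  shows "octahedral_norm TYPE('w dual dual)"
  unfolding octahedral_norm_def
proof (intro allI impI, elim exE conjE)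
  fix E B :: "'w dual dual set" and \<epsilon> :: real
  assume B: "finite B" "span B = E" and \<epsilon>: "0 < \<epsilon>"
  \<comment> \<open>The net estimate loses \<open>2 \<eta>\<close> and passing from the net to the sphere another \<open>\<eta>\<close>; the minimum
    keeps \<open>1 - \<eta>\<close> positive, as almost norming \<open>\<phi>\<close> demands.\<close>
  define \<eta> where "\<eta> = min \<epsilon> 1 / 3"
  have \<eta>: "0 < \<eta>" "\<eta> \<le> 1/3" "3 * \<eta> \<le> \<epsilon>" using \<epsilon> by (auto simp: \<eta>_def)
  obtain K where K: "finite K" "\<And>x. x \<in> K \<Longrightarrow> norm x = 1"
    "\<And>x. x \<in> E \<Longrightarrow> norm x = 1 \<Longrightarrow> \<exists>k\<in>K. norm (x - k) < \<eta>"
    using finite_net_of_unit_sphere[OF B(1) \<eta>(1)] B(2) by blast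
  obtain F0 :: "'w dual dual" where F0: "norm F0 = 1"
    using nz norming_functional_on_dual[of 0] by (metis order_refl zero_less_norm_iff)
  \<comment> \<open>The unit functional \<open>F0\<close> joins the net so that there is at least one slice even if \<open>E\<close> is trivial.\<close>
  obtain fs where fs: "set fs = insert F0 K" using finite_list[of "insert F0 K"] K(1) by auto
  define k where "k = length fs"
  define f where "f i = fs ! (i - 1)" for i
  have k: "1 \<le> k" using fs by (cases fs) (auto simp: k_def)
  have f1: "norm (f i) = 1" if "i \<in> {1..k}" for i
  proof -
    have "f i \<in> insert F0 K" unfolding fs[symmetric] f_def using that by (auto simp: k_def)
    then show ?thesis using K(2) F0 by auto
  qed
  have f_surj: "\<exists>i\<in>{1..k}. f i = g" if "g \<in> K" for g
  proof -
    have "g \<in> set fs" using that fs by simp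
    then obtain j where "j < length fs" "fs ! j = g" by (auto simp: in_set_conv_nth)
    then show ?thesis by (intro bexI[of _ "Suc j"]) (auto simp: f_def k_def)
  qed
  have sl: "\<forall>i\<in>{1..k}. slice (f i) \<eta> \<in> ball_slices"
    using f1 \<eta>(1) unfolding ball_slices_def by blast
  obtain x \<phi> where \<phi>: "1 - \<eta> < norm \<phi>"
    and x: "\<forall>i\<in>{1..k}. x i + \<phi> \<in> slice (f i) \<eta> \<and> x i - \<phi> \<in> slice (f i) \<eta>"
    by (rule SSD2PD[OF SSD2P k sl \<eta>(1)])
  obtain F where F: "norm F = 1" "1 - \<eta> < blinfun_apply F \<phi>"
    using norming_functional_on_dual[OF \<phi>] \<eta> by auto
  have F_le: "blinfun_apply F z \<le> 1" if "norm z \<le> 1" for z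
    using norm_blinfun[of F z] that F(1) by simp
  have net: "(1 - 2 * \<eta>) * (1 + \<bar>t\<bar>) \<le> norm (f i + t *\<^sub>R F)" if i: "i \<in> {1..k}" for i t
  proof -
    have norms: "norm (x i + \<phi>) \<le> 1" "norm (x i - \<phi>) \<le> 1"
      and big: "1 - \<eta> < blinfun_apply (f i) (x i + \<phi>)" "1 - \<eta> < blinfun_apply (f i) (x i - \<phi>)"
      using x i by (auto simp: slice_def)
    have "blinfun_apply F (x i) + blinfun_apply F \<phi> \<le> 1"
      "- blinfun_apply F (x i) + blinfun_apply F \<phi> \<le> 1"
      using F_le[OF norms(1)] F_le[of "- (x i - \<phi>)"] norms(2) norm_minus_commute[of "x i" \<phi>]
      by (simp_all add: blinfun.add_right blinfun.diff_right blinfun.minus_right)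
    then have Fx: "1 - 2 * \<eta> \<le> blinfun_apply F (x i + \<phi>)" "blinfun_apply F (x i - \<phi>) \<le> - (1 - 2 * \<eta>)"
      using F(2) by (simp_all add: blinfun.add_right blinfun.diff_right)
    define z where "z = (if 0 \<le> t then x i + \<phi> else x i - \<phi>)"
    have "\<bar>t\<bar> * (1 - 2 * \<eta>) \<le> t * blinfun_apply F z"
    proof (cases "0 \<le> t")
      case True
      then show ?thesis using Fx(1) by (auto simp: z_def intro: mult_left_mono)
    next
      case False
      then show ?thesis using mult_left_mono[of "1 - 2 * \<eta>" "- blinfun_apply F (x i - \<phi>)" "- t"] Fx(2)
        by (simp add: z_def)
    qed
    moreover have "1 - 2 * \<eta> \<le> blinfun_apply (f i) z" using big \<eta> by (auto simp: z_def)
    ultimately have "(1 - 2 * \<eta>) * (1 + \<bar>t\<bar>) \<le> blinfun_apply (f i + t *\<^sub>R F) z"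
      by (simp add: plus_blinfun.rep_eq scaleR_blinfun.rep_eq algebra_simps)
    also have "\<dots> \<le> norm (f i + t *\<^sub>R F) * norm z" using norm_blinfun[of "f i + t *\<^sub>R F" z] by simp
    also have "\<dots> \<le> norm (f i + t *\<^sub>R F)" using norms by (intro mult_left_le) (auto simp: z_def)
    finally show ?thesis .
  qed
  have unit: "(1 - \<epsilon>) * (1 + \<bar>t\<bar>) \<le> norm (y + t *\<^sub>R F)" if y: "y \<in> E" "norm y = 1" for y t
  proof -
    obtain i where i: "i \<in> {1..k}" "norm (y - f i) < \<eta>" using K(3)[OF y] f_surj by metis
    have "f i + t *\<^sub>R F = (y + t *\<^sub>R F) - (y - f i)" by simp
    then have "norm (f i + t *\<^sub>R F) \<le> norm (y + t *\<^sub>R F) + norm (y - f i)"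
      using norm_triangle_ineq4 by metis
    moreover have "\<eta> \<le> \<eta> * (1 + \<bar>t\<bar>)" using \<eta>(1) by (simp add: algebra_simps)
    moreover have "3 * \<eta> * (1 + \<bar>t\<bar>) \<le> \<epsilon> * (1 + \<bar>t\<bar>)"
      by (rule mult_right_mono) (use \<eta> in auto)
    ultimately show ?thesis using net[OF i(1), of t] i(2) by (simp add: algebra_simps)
  qed
  show "\<exists>z. norm z = 1 \<and> (\<forall>y\<in>E. \<forall>t. (1 - \<epsilon>) * (norm y + \<bar>t\<bar>) \<le> norm (y + t *\<^sub>R z))"
  proof (intro exI[of _ F] conjI ballI allI F(1))
    fix y :: "'w dual dual" and t :: real
    assume y: "y \<in> E"
    show "(1 - \<epsilon>) * (norm y + \<bar>t\<bar>) \<le> norm (y + t *\<^sub>R F)"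
    proof (cases "y = 0")
      case True
      have "(1 - \<epsilon>) * \<bar>t\<bar> \<le> 1 * \<bar>t\<bar>" by (rule mult_right_mono) (use \<epsilon> in auto)
      then show ?thesis using True F(1) by simp
    next
      case False
      define u where "u = y /\<^sub>R norm y"
      have "u \<in> E" unfolding u_def B(2)[symmetric] by (rule span_scale) (use y B(2) in simp)
      moreover have "norm u = 1" using False by (simp add: u_def)
      ultimately have "norm y * ((1 - \<epsilon>) * (1 + \<bar>t / norm y\<bar>)) \<le> norm y * norm (u + (t / norm y) *\<^sub>R F)"
        by (intro mult_left_mono unit) auto
      also have "\<dots> = norm (norm y *\<^sub>R (u + (t / norm y) *\<^sub>R F))" by simp
      also have "norm y *\<^sub>R (u + (t / norm y) *\<^sub>R F) = y + t *\<^sub>R F"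
        using False by (simp add: u_def scaleR_add_right)
      also have "norm y * ((1 - \<epsilon>) * (1 + \<bar>t / norm y\<bar>)) = (1 - \<epsilon>) * (norm y + \<bar>t\<bar>)"
        using False by (simp add: field_simps)
      finally show ?thesis .
    qed
  qed
qed

section \<open>Invariance under isometric isomorphism\<close>

lemma SSD2P_isometry:
  assumes iso: "isometrically_isomorphic TYPE('v::real_normed_vector) TYPE('z::real_normed_vector)"
    and V: "SSD2P TYPE('v)"
  shows "SSD2P TYPE('z)"
  unfolding SSD2P_def
proof (intro allI impI)
  fix k :: nat and S :: "nat \<Rightarrow> 'z set" and \<epsilon> :: real
  assume k: "1 \<le> k" and S: "\<forall>i\<in>{1..k}. S i \<in> ball_slices" and \<epsilon>: "0 < \<epsilon>"
  obtain J :: "'v \<Rightarrow> 'z" where J: "linear J" "surj J" "\<And>x. norm (J x) = norm x"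
    using iso unfolding isometrically_isomorphic_def by blast
  have bl: "bounded_linear J"
    using J(1,3) by (auto simp: linear_conv_bounded_linear[symmetric] bounded_linear_def
      bounded_linear_axioms_def linear_iff intro!: exI[of _ 1] linearI)
  have "J -` A \<in> ball_slices" if A: "A \<in> ball_slices" for A
  proof -
    obtain F \<alpha> where F: "A = slice F \<alpha>" "norm F = 1" "0 < \<alpha>" using A unfolding ball_slices_def by blast
    define G where "G = F o\<^sub>L Blinfun J"
    have G: "blinfun_apply G x = blinfun_apply F (J x)" for x
      by (simp add: G_def bounded_linear_Blinfun_apply[OF bl])
    have "norm G = norm F"
    proof (rule antisym)
      show "norm G \<le> norm F"
      proof (rule norm_blinfun_bound)
        show "norm (blinfun_apply G x) \<le> norm F * norm x" for x
          using norm_blinfun[of F "J x"] by (simp add: G J(3))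
      qed simp
      show "norm F \<le> norm G"
      proof (rule norm_blinfun_bound)
        fix z obtain x where x: "z = J x" using J(2) by blast
        show "norm (blinfun_apply F z) \<le> norm G * norm z"
          using norm_blinfun[of G x] by (simp add: G J(3) x)
      qed simp
    qed
    moreover have "J -` A = slice G \<alpha>" by (auto simp: F(1) slice_def G J(3))
    ultimately show ?thesis using F unfolding ball_slices_def by auto
  qed
  then have sl: "\<forall>i\<in>{1..k}. J -` S i \<in> ball_slices" using S by blast
  obtain x \<phi> where x: "norm \<phi> \<le> 1" "1 - \<epsilon> < norm \<phi>" "\<forall>i\<in>{1..k}. x i \<in> J -` S i"
    "\<forall>i\<in>{1..k}. x i + \<phi> \<in> J -` S i \<and> x i - \<phi> \<in> J -` S i"
    by (rule SSD2PD[OF V k sl \<epsilon>])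
  from x show "\<exists>x \<phi>. (\<forall>i\<in>{1..k}. x i \<in> S i) \<and> \<phi> \<in> cball 0 1 \<and> norm \<phi> > 1 - \<epsilon> \<and>
           (\<forall>i\<in>{1..k}. x i + \<phi> \<in> S i \<and> x i - \<phi> \<in> S i)"
    by (intro exI[of _ "\<lambda>i. J (x i)"] exI[of _ "J \<phi>"])
      (auto simp: J(3) linear_add[OF J(1)] linear_diff[OF J(1)])
qed

lemma CEP_isometry:
  assumes iso: "isometrically_isomorphic TYPE('v::real_normed_vector) TYPE('z::real_normed_vector)"
    and CEP: "CEP TYPE('m::metric_space) TYPE('v)"
  shows "CEP TYPE('m) TYPE('z)"
  unfolding CEP_def
proof (intro allI impI)
  fix N :: "'m set" and f :: "'m \<Rightarrow> 'z"
  assume f: "lipschitz_fun_on N f"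
  obtain J :: "'v \<Rightarrow> 'z" where J: "linear J" "surj J" "\<And>x. norm (J x) = norm x"
    using iso unfolding isometrically_isomorphic_def by blast
  have diff: "norm (J x - J y) = norm (x - y)" for x y
    by (simp add: J(3) flip: linear_diff[OF J(1)])
  have lip: "lipschitz_fun_on A (\<lambda>x. J (h x)) \<longleftrightarrow> lipschitz_fun_on A h"
    "lip_const A (\<lambda>x. J (h x)) = lip_const A h" for A and h :: "'m \<Rightarrow> 'v"
    by (simp_all add: lipschitz_fun_on_def lipschitz_on_def lip_const_def dist_norm diff)
  define h where "h x = inv J (f x)" for x
  have h: "f = (\<lambda>x. J (h x))" by (simp add: h_def surj_f_inv_f[OF J(2)])
  obtain H where "lipschitz_fun_on UNIV H" "\<forall>x\<in>N. H x = h x" "lip_const UNIV H = lip_const N h"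
    using CEP f unfolding CEP_def h lip by blast
  then show "\<exists>F. lipschitz_fun_on UNIV F \<and> (\<forall>x\<in>N. F x = f x) \<and> lip_const UNIV F = lip_const N f"
    by (intro exI[of _ "\<lambda>x. J (H x)"]) (simp add: h lip)
qed

section \<open>The dual of the vector-valued Lipschitz-free space\<close>

lemma norm_lf_delta_diff_le: "norm (lf_delta m y - lf_delta m' y) \<le> dist m m' * norm y"
proof (rule norm_blinfun_bound)
  fix f :: "('a, 'b dual) lip0"
  have "norm (blinfun_apply (lip0_apply f m - lip0_apply f m') y)
      \<le> norm (lip0_apply f m - lip0_apply f m') * norm y" by (rule norm_blinfun)
  also have "\<dots> \<le> (norm f * dist m m') * norm y"
    by (intro mult_right_mono norm_lip0_apply_diff) simp
  finally show "norm (blinfun_apply (lf_delta m y - lf_delta m' y) f) \<le> dist m m' * norm y * norm f"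
    by (simp add: lf_delta.rep_eq minus_blinfun.rep_eq mult_ac)
qed simp

lemma lf_delta_add: "lf_delta m (y + y') = lf_delta m y + lf_delta m y'"
  by (rule blinfun_eqI) (simp add: lf_delta.rep_eq plus_blinfun.rep_eq blinfun.add_right)

lemma lf_delta_scaleR: "lf_delta m (a *\<^sub>R y) = a *\<^sub>R lf_delta m y"
  by (rule blinfun_eqI) (simp add: lf_delta.rep_eq scaleR_blinfun.rep_eq blinfun.scaleR_right)

lemma lf_delta_origin: "lf_delta origin y = 0"
  by (rule blinfun_eqI) (simp add: lf_delta.rep_eq lip0_apply_origin)

lift_definition free_delta :: "'m::pointed_metric_space \<Rightarrow> 'y::real_normed_vector \<Rightarrow> ('m, 'y) lip_free"
  is lf_delta
  by (rule subsetD[OF closure_subset]) (auto intro: span_base)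

lemma norm_free_delta_diff_le: "norm (free_delta m y - free_delta m' y) \<le> dist m m' * norm y"
  by transfer (rule norm_lf_delta_diff_le)

lemma free_delta_add: "free_delta m (y + y') = free_delta m y + free_delta m y'"
  by transfer (rule lf_delta_add)

lemma free_delta_scaleR: "free_delta m (a *\<^sub>R y) = a *\<^sub>R free_delta m y"
  by transfer (rule lf_delta_scaleR)

lemma free_delta_origin: "free_delta origin y = 0"
  by transfer (rule lf_delta_origin)

text \<open>The vectors \<open>free_delta m y\<close> span a dense subspace. The induction runs over the span inside the
dual of the Lipschitz space, where \<open>span\<close> and \<open>closure\<close> are available from the construction of the type, and
carries along the membership in the closure that makes \<open>Abs_lip_free\<close> faithful there.\<close>

lemma lip_free_functionals_eqI:
  fixes G H :: "('m::pointed_metric_space, 'y::real_normed_vector) lip_free dual"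
  assumes eq: "\<And>m y. blinfun_apply G (free_delta m y) = blinfun_apply H (free_delta m y)"
  shows "G = H"
proof (rule blinfun_eqI)
  fix \<mu> :: "('m, 'y) lip_free"
  define D :: "('m, 'y dual) lip0 dual set" where "D = {lf_delta m y | m y. True}"
  have in_closure: "Abs_lip_free v \<in> {\<nu>. blinfun_apply G \<nu> = blinfun_apply H \<nu>} \<and> v \<in> closure (span D)"
    if "v \<in> span D" for v
    using that
  proof (induction rule: span_induct_alt)
    case base
    have "Abs_lip_free 0 = (0 :: ('m, 'y) lip_free)" by (simp add: zero_lip_free_def)
    then show ?case using closure_subset span_zero by (auto simp: blinfun.zero_right)
  next
    case (step c v w)
    obtain m y where v: "v = lf_delta m y" using step(1) by (auto simp: D_def)
    have w: "w \<in> closure (span D)" using step(2) by simp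
    define \<nu> where "\<nu> = c *\<^sub>R free_delta m y + Abs_lip_free w"
    have emb: "lip_free_emb \<nu> = c *\<^sub>R v + w"
      using w by (simp add: plus_lip_free.rep_eq scaleR_lip_free.rep_eq free_delta.rep_eq v
          Abs_lip_free_inverse D_def \<nu>_def)
    have "Abs_lip_free (c *\<^sub>R v + w) = \<nu>" "c *\<^sub>R v + w \<in> closure (span D)"
      using lip_free_emb_inverse[of \<nu>] lip_free_emb[of \<nu>] by (simp_all add: emb D_def)
    then show ?case using step(2)
      by (simp add: \<nu>_def blinfun.add_right blinfun.scaleR_right eq)
  qed
  have "lip_free_emb \<mu> \<in> closure (span D)" using lip_free_emb[of \<mu>] by (simp add: D_def)
  then obtain v where v: "\<And>n. v n \<in> span D" "v \<longlonglongrightarrow> lip_free_emb \<mu>"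
    unfolding closure_sequential by blast
  have "norm (Abs_lip_free (v n) - \<mu>) = norm (v n - lip_free_emb \<mu>)" for n
    using in_closure[OF v(1)] by (simp add: norm_lip_free.rep_eq minus_lip_free.rep_eq
        Abs_lip_free_inverse D_def)
  then have lim: "(\<lambda>n. Abs_lip_free (v n)) \<longlonglongrightarrow> \<mu>" using v(2) by (simp add: LIMSEQ_iff)
  have "(\<lambda>n. blinfun_apply G (Abs_lip_free (v n))) \<longlonglongrightarrow> blinfun_apply G \<mu>"
    "(\<lambda>n. blinfun_apply H (Abs_lip_free (v n))) \<longlonglongrightarrow> blinfun_apply H \<mu>"
    by (intro tendsto_intros lim)+
  moreover have "blinfun_apply G (Abs_lip_free (v n)) = blinfun_apply H (Abs_lip_free (v n))" for n
    using in_closure[OF v(1)] by simp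
  ultimately show "blinfun_apply G \<mu> = blinfun_apply H \<mu>" using LIMSEQ_unique by simp
qed

text \<open>The canonical map from Lipschitz functions to functionals on the Lipschitz-free space; it is shown to
be a surjective isometry.\<close>

lift_definition free_pairing ::
    "('m::pointed_metric_space, 'y::real_normed_vector dual) lip0 \<Rightarrow> ('m, 'y) lip_free dual"
  is "\<lambda>f \<mu>. blinfun_apply (lip_free_emb \<mu>) f"
proof (rule bounded_linear_intro)
  fix f :: "('m, 'y dual) lip0" and \<mu> \<nu> :: "('m, 'y) lip_free" and r :: real
  show "blinfun_apply (lip_free_emb (\<mu> + \<nu>)) f
      = blinfun_apply (lip_free_emb \<mu>) f + blinfun_apply (lip_free_emb \<nu>) f"
    by (simp add: plus_lip_free.rep_eq plus_blinfun.rep_eq)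
  show "blinfun_apply (lip_free_emb (r *\<^sub>R \<mu>)) f = r *\<^sub>R blinfun_apply (lip_free_emb \<mu>) f"
    by (simp add: scaleR_lip_free.rep_eq scaleR_blinfun.rep_eq)
  show "norm (blinfun_apply (lip_free_emb \<mu>) f) \<le> norm \<mu> * norm f"
    using norm_blinfun[of "lip_free_emb \<mu>" f] by (simp add: norm_lip_free.rep_eq)
qed

lemma free_pairing_delta: "blinfun_apply (free_pairing f) (free_delta m y) = blinfun_apply (lip0_apply f m) y"
  by (simp add: free_pairing.rep_eq free_delta.rep_eq lf_delta.rep_eq)

lemma norm_free_pairing: "norm (free_pairing f) = norm f"
proof (rule antisym)
  show "norm (free_pairing f) \<le> norm f"
  proof (rule norm_blinfun_bound)
    show "norm (blinfun_apply (free_pairing f) \<mu>) \<le> norm f * norm \<mu>" for \<mu>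
      using norm_blinfun[of "lip_free_emb \<mu>" f]
      by (simp add: free_pairing.rep_eq norm_lip_free.rep_eq mult.commute)
  qed simp
  show "norm f \<le> norm (free_pairing f)"
  proof (rule norm_lip0_le)
    fix x y
    show "norm (lip0_apply f x - lip0_apply f y) \<le> norm (free_pairing f) * dist x y"
    proof (rule norm_blinfun_bound)
      fix v
      have "blinfun_apply (lip0_apply f x - lip0_apply f y) v
          = blinfun_apply (free_pairing f) (free_delta x v - free_delta y v)"
        by (simp add: minus_blinfun.rep_eq blinfun.diff_right free_pairing_delta)
      also have "norm \<dots> \<le> norm (free_pairing f) * norm (free_delta x v - free_delta y v)"
        by (rule norm_blinfun)
      also have "\<dots> \<le> norm (free_pairing f) * (dist x y * norm v)"
        by (intro mult_left_mono norm_free_delta_diff_le) simp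
      finally show "norm (blinfun_apply (lip0_apply f x - lip0_apply f y) v)
          \<le> norm (free_pairing f) * dist x y * norm v" by (simp add: mult.assoc)
    qed simp
  qed simp
qed

text \<open>A functional \<open>G\<close> comes from the function that sends \<open>m\<close> to the functional \<open>\<lambda>y. G (free_delta m y)\<close>.\<close>

lemma surj_free_pairing:
  "surj (free_pairing :: ('m::pointed_metric_space, 'y::real_normed_vector dual) lip0 \<Rightarrow> _)"
proof -
  have "\<exists>f. G = free_pairing f" for G :: "('m, 'y) lip_free dual"
  proof -
    define h where "h m = Blinfun (\<lambda>y. blinfun_apply G (free_delta m y))" for m
    have bound: "norm (blinfun_apply G (free_delta m y) - blinfun_apply G (free_delta m' y))
        \<le> norm G * dist m m' * norm y" for m m' y
    proof -
      have "norm (blinfun_apply G (free_delta m y - free_delta m' y))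
          \<le> norm G * norm (free_delta m y - free_delta m' y)" by (rule norm_blinfun)
      also have "\<dots> \<le> norm G * (dist m m' * norm y)"
        by (intro mult_left_mono norm_free_delta_diff_le) simp
      finally show ?thesis by (simp add: blinfun.diff_right mult.assoc)
    qed
    have "bounded_linear (\<lambda>y. blinfun_apply G (free_delta m y))" for m
    proof (rule bounded_linear_intro)
      show "norm (blinfun_apply G (free_delta m y)) \<le> norm y * (norm G * dist m origin)" for y
        using bound[of m y origin] by (simp add: free_delta_origin blinfun.zero_right mult.commute)
    qed (simp_all add: free_delta_add free_delta_scaleR blinfun.add_right blinfun.scaleR_right)
    then have h: "blinfun_apply (h m) y = blinfun_apply G (free_delta m y)" for m y
      by (simp add: h_def bounded_linear_Blinfun_apply)
    have "(norm G)-lipschitz_on UNIV h"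
    proof (rule lipschitz_onI)
      fix m m'
      have "norm (h m - h m') \<le> norm G * dist m m'"
        by (rule norm_blinfun_bound) (use bound in \<open>auto simp: minus_blinfun.rep_eq h\<close>)
      then show "dist (h m) (h m') \<le> norm G * dist m m'" by (simp add: dist_norm)
    qed simp
    moreover have "h origin = 0"
      by (rule blinfun_eqI) (simp add: h free_delta_origin blinfun.zero_right)
    ultimately obtain f where "lip0_apply f = h" using lip0_exists by blast
    then have "G = free_pairing f"
      by (intro lip_free_functionals_eqI) (simp add: free_pairing_delta h)
    then show ?thesis by blast
  qed
  then show ?thesis by blast
qed

lemma lip_free_dual_isometry:
  "isometrically_isomorphic TYPE(('m::pointed_metric_space, 'y::real_normed_vector dual) lip0)
     TYPE(('m, 'y) lip_free dual)"
  unfolding isometrically_isomorphic_def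
proof (intro exI[of _ free_pairing] conjI allI surj_free_pairing norm_free_pairing linearI)
  show "free_pairing (f + g) = free_pairing f + free_pairing g" for f g :: "('m, 'y dual) lip0"
    by (rule blinfun_eqI) (simp add: free_pairing.rep_eq plus_blinfun.rep_eq blinfun.add_right)
  show "free_pairing (a *\<^sub>R f) = a *\<^sub>R free_pairing f" for a and f :: "('m, 'y dual) lip0"
    by (rule blinfun_eqI) (simp add: free_pairing.rep_eq scaleR_blinfun.rep_eq blinfun.scaleR_right)
qed

section \<open>Octahedrality of the bidual of the Lipschitz-free space\<close>

theorem theorem2p6:
  assumes "\<exists>x::'x::banach. x \<noteq> 0"
    and "CEP TYPE('m::{pointed_metric_space, complete_space}) TYPE('x)"
    and "\<not> bounded (UNIV :: 'm set) \<or> \<not> uniform_discrete (UNIV :: 'm set)"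
  shows "SSD2P TYPE(('m, 'x) lip0) \<and>
    (isometrically_isomorphic TYPE('x) TYPE('y::banach dual) \<longrightarrow>
       octahedral_norm TYPE(('m, 'y) lip_free dual dual))"
proof (intro conjI impI)
  show "SSD2P TYPE(('m, 'x) lip0)" by (rule SSD2P_lip0[OF assms])
next
  assume iso: "isometrically_isomorphic TYPE('x) TYPE('y dual)"
  obtain J :: "'x \<Rightarrow> 'y dual" where J: "\<And>x. norm (J x) = norm x"
    using iso unfolding isometrically_isomorphic_def by blast
  obtain x :: 'x where "x \<noteq> 0" using assms(1) by blast
  then have "J x \<noteq> 0" using J[of x] by auto
  then have nz: "\<exists>v :: 'y dual. v \<noteq> 0" by blast
  have "SSD2P TYPE(('m, 'y dual) lip0)"
    by (rule SSD2P_lip0[OF nz CEP_isometry[OF iso assms(2)] assms(3)])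
  then have "SSD2P TYPE(('m, 'y) lip_free dual)"
    by (rule SSD2P_isometry[OF lip_free_dual_isometry])
  moreover have "\<exists>G :: ('m, 'y) lip_free dual. G \<noteq> 0"
  proof -
    obtain v :: "'y dual" where v: "v \<noteq> 0" using nz by blast
    have "\<exists>m::'m. m \<noteq> origin"
    proof (rule ccontr)
      assume "\<nexists>m::'m. m \<noteq> origin"
      then have U: "UNIV = {origin :: 'm}" by blast
      show False using assms(3) unfolding U by (simp add: uniform_discrete_def exI[of _ 1])
    qed
    then obtain m :: 'm where m: "m \<noteq> origin" by blast
    \<comment> \<open>A nonzero functional on the free space comes from a nonzero Lipschitz function, such as
      the distance to the origin times \<open>v\<close>.\<close>
    have "(norm v)-lipschitz_on UNIV (\<lambda>x::'m. dist x origin *\<^sub>R v)"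
    proof (rule lipschitz_onI)
      fix x y :: 'm
      show "dist (dist x origin *\<^sub>R v) (dist y origin *\<^sub>R v) \<le> norm v * dist x y"
        using abs_dist_diff_le[of x origin y] 
        by (simp add: dist_norm dist_commute mult.commute mult_left_mono flip: scaleR_diff_left)
    qed simp
    then obtain f where f: "lip0_apply f = (\<lambda>x::'m. dist x origin *\<^sub>R v)"
      using lip0_exists[of "\<lambda>x::'m. dist x origin *\<^sub>R v"] by auto
    have "f \<noteq> 0"
    proof
      assume "f = 0"
      then have "lip0_apply f m = 0" by (simp add: zero_lip0.rep_eq)
      then show False using f m v by simp
    qed
    then have "free_pairing f \<noteq> 0" using norm_free_pairing[of f] by auto
    then show ?thesis by blast
  qed
  ultimately show "octahedral_norm TYPE(('m, 'y) lip_free dual dual)"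
    by (rule SSD2P_imp_octahedral_dual)
qed

end
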